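(* There exists $\mu_0\in[5/32,1/2)$ such that for all $\mu\in(\mu_0,1/2)$ the function $\varphi_1(z)=\frac{1}{\sqrt{\pi}}ze^{-|z|^2/2}$ is the unique global minimizer, up to space and phase rotations, of $\mathcal{G}_\mu$ over $\{u\in\mathcal{E}:M(u)=1\}$.
   Context: $L$ denotes Lebesgue measure on $\mathbb{C}$. The Bargmann-Fock space is $\mathcal{E}=\{u(z)=e^{-|z|^2/2}f(z): f \text{ entire holomorphic on } \mathbb{C}\}\cap L^2(\mathbb{C})$. For $u\in\mathcal{E}$ set $\mathcal{H}(u)=\frac14\int_{\mathbb{C}}|u|^4\,dL$, $M(u)=\int_{\mathbb{C}}|u|^2\,dL$, $P(u)=\int_{\mathbb{C}}(|z|^2-1)|u(z)|^2\,dL(z)$ (possibly $+\infty$), and $\mathcal{G}_\mu(u)=8\pi\mathcal{H}(u)+\mu P(u)$ for $\mu>0$. A global minimizer is a $u\in\mathcal{E}$ with $M(u)=1$ and $\mathcal{G}_\mu(u)\le\mathcal{G}_\mu(v)$ for all $v\in\mathcal{E}$ with $M(v)=1$. Phase rotations are the maps $u(z)\mapsto e^{i\gamma}u(z)$, $\gamma\in\mathbb{R}$; space rotations are the maps $u(z)\mapsto u(e^{i\theta}z)$, $\theta\in\mathbb{R}$. *)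

theory Defs
  imports "HOL-Complex_Analysis.Complex_Analysis"
begin

definition L2_complex :: "(complex \<Rightarrow> complex) set" where
  "L2_complex = {u \<in> borel_measurable lborel. integrable lborel (\<lambda>z. (cmod (u z))\<^sup>2)}"

definition bargmann_fock :: "(complex \<Rightarrow> complex) set" where
  "bargmann_fock =
     {u. \<exists>f. f holomorphic_on UNIV \<and>
             u = (\<lambda>z. complex_of_real (exp (- (cmod z)\<^sup>2 / 2)) * f z)} \<inter> L2_complex"

(* Elements of bargmann_fock are bounded, so |u|^4 is integrable for them and the
   Bochner integral never takes its default value 0 there. *)
definition energy_H :: "(complex \<Rightarrow> complex) \<Rightarrow> real" where
  "energy_H u = 1 / 4 * (\<integral>z. (cmod (u z)) ^ 4 \<partial>lborel)"

definition mass_M :: "(complex \<Rightarrow> complex) \<Rightarrow> real" where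
  "mass_M u = (\<integral>z. (cmod (u z))\<^sup>2 \<partial>lborel)"

(* The extended-valued integral of (|z|^2 - 1) |u(z)|^2 as positive part minus negative part
   (ennreal sends negative reals to 0). The negative part is at most |u|^2, hence has a finite
   integral for u in L^2, so the value is a real number or +infinity. *)
definition momentum_P :: "(complex \<Rightarrow> complex) \<Rightarrow> ereal" where
  "momentum_P u =
     enn2ereal (\<integral>\<^sup>+z. ennreal (((cmod z)\<^sup>2 - 1) * (cmod (u z))\<^sup>2) \<partial>lborel) -
     enn2ereal (\<integral>\<^sup>+z. ennreal (- (((cmod z)\<^sup>2 - 1) * (cmod (u z))\<^sup>2)) \<partial>lborel)"

definition functional_G :: "real \<Rightarrow> (complex \<Rightarrow> complex) \<Rightarrow> ereal" where
  "functional_G \<mu> u = ereal (8 * pi * energy_H u) + ereal \<mu> * momentum_P u"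

definition global_minimizer :: "real \<Rightarrow> (complex \<Rightarrow> complex) \<Rightarrow> bool" where
  "global_minimizer \<mu> u \<longleftrightarrow>
     u \<in> bargmann_fock \<and> mass_M u = 1 \<and>
     (\<forall>v \<in> bargmann_fock. mass_M v = 1 \<longrightarrow> functional_G \<mu> u \<le> functional_G \<mu> v)"

definition phase_rotation :: "real \<Rightarrow> (complex \<Rightarrow> complex) \<Rightarrow> (complex \<Rightarrow> complex)" where
  "phase_rotation \<gamma> u = (\<lambda>z. exp (\<i> * complex_of_real \<gamma>) * u z)"

definition space_rotation :: "real \<Rightarrow> (complex \<Rightarrow> complex) \<Rightarrow> (complex \<Rightarrow> complex)" where
  "space_rotation \<theta> u = (\<lambda>z. u (exp (\<i> * complex_of_real \<theta>) * z))"

(* Phase and space rotations commute and each form a group, so compositions of one of each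
   give the whole orbit. *)
definition unique_global_minimizer_up_to_rotations ::
    "real \<Rightarrow> (complex \<Rightarrow> complex) \<Rightarrow> bool" where
  "unique_global_minimizer_up_to_rotations \<mu> u \<longleftrightarrow>
     global_minimizer \<mu> u \<and>
     (\<forall>v. global_minimizer \<mu> v \<longrightarrow> (\<exists>\<gamma> \<theta>. v = phase_rotation \<gamma> (space_rotation \<theta> u)))"

definition phi1 :: "complex \<Rightarrow> complex" where
  "phi1 z = complex_of_real (1 / sqrt pi) * z * complex_of_real (exp (- (cmod z)\<^sup>2 / 2))"

end

theory Submission
  imports Defs "HOL-Probability.Distributions"
begin

text \<open>Write \<open>a\<close> for the coefficients of \<open>u\<close> in the orthonormal basis
  \<open>z\<^sup>n exp (- \<bar>z\<bar>\<^sup>2 / 2) / sqrt (\<pi> n!)\<close>. Then \<open>8 \<pi> H\<close> is the squared norm \<open>p\<^sub>0\<close> of the part of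
  \<open>a \<otimes> a\<close> with relative angular momentum 0. Only even relative angular momenta \<open>m\<close> occur, with
  weights \<open>p\<^sub>m\<close> of total 1, and their mean is \<open>P - \<bar>Q\<bar>\<^sup>2\<close> where \<open>Q\<close> is the expectation of the
  annihilation operator. Hence the excess \<open>E = p\<^sub>0 + P / 2 - 1\<close> equals
  \<open>\<bar>Q\<bar>\<^sup>2 / 2 + (\<Sum>m\<ge>4. (m / 2 - 1) p\<^sub>m) \<ge> 0\<close>, and with \<open>\<epsilon> = 1 / 2 - \<mu>\<close> the functional exceeds its value
  at \<open>\<phi>\<^sub>1\<close> by \<open>E - \<epsilon> (P - 1)\<close>. So it is enough that \<open>P - 1 \<le> C E\<close>. If \<open>E\<close> is small and \<open>P \<ge> 1\<close>,
  comparing the first two moments of \<open>m\<close> shows that \<open>a\<close> is close to the first mode, and there the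
  quadratic expansion of \<open>E\<close> controls \<open>P - 1\<close>.

  On pairs of total degree \<open>k\<close> the relative angular momentum operator is, after dividing by square
  roots of binomial coefficients, the Dirichlet form of the symmetric binomial distribution, so the
  required spectral gaps are Poincare inequalities for that distribution.\<close>


section \<open>Averages against the symmetric binomial distribution\<close>

text \<open>The bound \<open>P - 1 <= C E\<close> has to be one-sided: E vanishes at mode 0 as well
  as at mode 1, and P = 0 there, so E controls neither |P - 1| nor the distance to the first mode.
  The global step therefore assumes P >= 1, and the local step bounds P - 1 only from above. The
  obstacle in the global step is that E gives a first moment of m, while locating the first mode
  takes a second one. On total degree k only m <= k occurs, so m (m - 1) <= m + k (m - 2) for even m
  >= 2; the factor k is unbounded, and the second moment may be infinite. Damping mode n by r^n caps
  k at the price of a little mass. In the local step the quadratic part of E degenerates on a real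
  plane spanned by directions in modes 0 and 2, but P - 1 is negative along it. All constants are
  explicit and generous, since only some interval of \<mu> below 1/2 is claimed.\<close>

primrec binomial_avg :: "nat \<Rightarrow> (nat \<Rightarrow> 'a::real_normed_field) \<Rightarrow> 'a" where
  "binomial_avg 0 g = g 0"
| "binomial_avg (Suc k) g = binomial_avg k (\<lambda>j. (g j + g (Suc j)) / 2)"

lemma sum_binomial_Suc:
  fixes g :: "nat \<Rightarrow> 'a::comm_semiring_1"
  shows "(\<Sum>j\<le>Suc k. of_nat (Suc k choose j) * g j) =
         (\<Sum>j\<le>k. of_nat (k choose j) * (g j + g (Suc j)))"
proof -
  have "(\<Sum>j\<le>Suc k. of_nat (Suc k choose j) * g j) =
        g 0 + (\<Sum>j\<le>k. of_nat (k choose j) * g (Suc j)) + (\<Sum>j\<le>k. of_nat (k choose Suc j) * g (Suc j))"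
    by (subst sum.atMost_Suc_shift) (simp add: algebra_simps sum.distrib)
  moreover have "(\<Sum>j\<le>k. of_nat (k choose j) * g j) =
        g 0 + (\<Sum>j\<le>k. of_nat (k choose Suc j) * g (Suc j))"
  proof -
    have "(\<Sum>j\<le>k. of_nat (k choose j) * g j) = (\<Sum>j\<le>Suc k. of_nat (k choose j) * g j)"
      by (simp add: binomial_eq_0)
    also have "\<dots> = g 0 + (\<Sum>j\<le>k. of_nat (k choose Suc j) * g (Suc j))"
      by (subst sum.atMost_Suc_shift) simp
    finally show ?thesis .
  qed
  ultimately show ?thesis
    by (simp add: algebra_simps sum.distrib)
qed

text \<open>The recursion integrates out one toss of a fair coin, which is the form that the
  inductions below use; the closed form serves the explicit evaluations.\<close>

lemma binomial_avg_eq_sum: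
  "binomial_avg k g = (\<Sum>j\<le>k. of_nat (k choose j) * g j) / 2 ^ k"
proof (induction k arbitrary: g)
  case (Suc k)
  show ?case
    unfolding sum_binomial_Suc
    by (simp add: Suc.IH sum_divide_distrib)
qed simp

lemma binomial_avg_cong:
  "(\<And>j. j \<le> k \<Longrightarrow> g j = h j) \<Longrightarrow> binomial_avg k g = binomial_avg k h"
  by (simp add: binomial_avg_eq_sum)

lemma binomial_avg_add:
  "binomial_avg k (\<lambda>j. g j + h j) = binomial_avg k g + binomial_avg k h"
  by (simp add: binomial_avg_eq_sum sum.distrib algebra_simps add_divide_distrib)

lemma binomial_avg_diff:
  "binomial_avg k (\<lambda>j. g j - h j) = binomial_avg k g - binomial_avg k h"
  by (simp add: binomial_avg_eq_sum sum_subtractf algebra_simps diff_divide_distrib)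

lemma binomial_avg_cmult:
  "binomial_avg k (\<lambda>j. c * g j) = c * binomial_avg k g"
  by (simp add: binomial_avg_eq_sum sum_distrib_left sum_divide_distrib algebra_simps)

lemma binomial_avg_nonneg:
  fixes g :: "nat \<Rightarrow> real"
  shows "(\<And>j. 0 \<le> g j) \<Longrightarrow> 0 \<le> binomial_avg k g"
  by (simp add: binomial_avg_eq_sum sum_nonneg)

lemma binomial_avg_antisymmetric:
  fixes y :: "nat \<Rightarrow> complex"
  assumes "\<And>i j. i + j = k \<Longrightarrow> y i = - y j"
  shows "binomial_avg k y = 0"
  using assms
proof (induction k arbitrary: y)
  case 0
  then have "y 0 = - y 0" by blast
  then show ?case by simp
next
  case (Suc k)
  have "binomial_avg k (\<lambda>j. (y j + y (Suc j)) / 2) = 0"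
  proof (rule Suc.IH)
    fix i j assume ij: "i + j = k"
    have "y i = - y (Suc j)" "y (Suc i) = - y j"
      using ij by (auto intro: Suc.prems)
    then show "(y i + y (Suc i)) / 2 = - ((y j + y (Suc j)) / 2)" by (simp add: field_simps)
  qed
  then show ?case by simp
qed

abbreviation diff_seq :: "(nat \<Rightarrow> complex) \<Rightarrow> nat \<Rightarrow> complex" where
  "diff_seq x \<equiv> \<lambda>j. x (Suc j) - x j"

abbreviation avg_sq :: "nat \<Rightarrow> (nat \<Rightarrow> complex) \<Rightarrow> real" where
  "avg_sq k x \<equiv> binomial_avg k (\<lambda>j. (cmod (x j))\<^sup>2)"

definition binomial_var :: "nat \<Rightarrow> (nat \<Rightarrow> complex) \<Rightarrow> real" where
  "binomial_var k x = avg_sq k x - (cmod (binomial_avg k x))\<^sup>2"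

lemma parallelogram_cmod:
  "(cmod (a + b))\<^sup>2 + (cmod (a - b))\<^sup>2 = 2 * (cmod a)\<^sup>2 + 2 * (cmod b)\<^sup>2"
  by (simp add: cmod_power2) (simp add: power2_eq_square algebra_simps)

text \<open>Variance decomposition for a single toss with the two outcomes a and b.\<close>

lemma parallelogram_mean:
  "((cmod a)\<^sup>2 + (cmod b)\<^sup>2) / 2 = (cmod ((a + b) / 2))\<^sup>2 + (cmod (b - a))\<^sup>2 / 4"
  using parallelogram_cmod[of b a] by (simp add: norm_divide power_divide add.commute)

lemma avg_sq_Suc:
  "avg_sq (Suc k) x = avg_sq k (\<lambda>j. (x j + x (Suc j)) / 2) + avg_sq k (diff_seq x) / 4"
proof -
  have "avg_sq (Suc k) x =
      binomial_avg k (\<lambda>j. (cmod ((x j + x (Suc j)) / 2))\<^sup>2 + (1/4) * (cmod (x (Suc j) - x j))\<^sup>2)"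
    by (simp only: binomial_avg.simps parallelogram_mean) simp
  then show ?thesis
    by (simp only: binomial_avg_add binomial_avg_cmult)
qed

text \<open>Law of total variance: the variance left after one toss has been averaged out, plus the
  mean conditional variance due to that toss.\<close>

lemma binomial_var_Suc:
  "binomial_var (Suc k) x =
     binomial_var k (\<lambda>j. (x j + x (Suc j)) / 2) + avg_sq k (diff_seq x) / 4"
  unfolding binomial_var_def avg_sq_Suc by simp

lemma binomial_var_nonneg: "0 \<le> binomial_var k x"
proof (induction k arbitrary: x)
  case 0
  show ?case by (simp add: binomial_var_def)
next
  case (Suc k)
  show ?case
    unfolding binomial_var_Suc by (intro add_nonneg_nonneg Suc.IH) (simp add: binomial_avg_nonneg)
qed

text \<open>Differencing commutes with averaging, so this is \<open>avg_sq_Suc\<close> for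
  \<open>diff_seq x\<close>. Averaging lowers the Dirichlet form by exactly a second-difference
  term: dropping that term gives the plain Poincare inequality, keeping it gives the symmetric
  one.\<close>

lemma avg_sq_diff_mean:
  "avg_sq k (diff_seq (\<lambda>j. (x j + x (Suc j)) / 2)) =
     avg_sq (Suc k) (diff_seq x) - avg_sq k (diff_seq (diff_seq x)) / 4"
proof -
  have *: "(x (Suc j) + x (Suc (Suc j))) / 2 - (x j + x (Suc j)) / 2
      = (diff_seq x j + diff_seq x (Suc j)) / 2" for j
    by (simp add: field_simps)
  show ?thesis
    unfolding avg_sq_Suc[of k "diff_seq x"] * by (rule add_diff_cancel_right'[symmetric])
qed

lemma binomial_poincare:
  "binomial_var (Suc k) x \<le> real (Suc k) / 4 * avg_sq k (diff_seq x)"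
proof (induction k arbitrary: x)
  case 0
  show ?case
    using binomial_var_Suc[of 0 x] by (simp add: binomial_var_def)
next
  case (Suc k)
  let ?m = "\<lambda>x j. (x j + x (Suc j)) / (2::complex)"
  have "binomial_var (Suc k) (?m x) \<le> real (Suc k) / 4 * avg_sq k (diff_seq (?m x))"
    by (rule Suc.IH)
  also have "\<dots> \<le> real (Suc k) / 4 * avg_sq (Suc k) (diff_seq x)"
  proof (rule mult_left_mono)
    show "avg_sq k (diff_seq (?m x)) \<le> avg_sq (Suc k) (diff_seq x)"
      unfolding avg_sq_diff_mean by (simp del: binomial_avg.simps add: binomial_avg_nonneg)
  qed simp
  finally show ?case
    unfolding binomial_var_Suc[of "Suc k"] by (simp del: binomial_avg.simps add: field_simps)
qed

text \<open>Symmetric functions have no component along the first nonconstant eigenspace, which doubles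
  the spectral gap.\<close>

lemma binomial_poincare_symmetric:
  assumes "\<And>i j. i + j = Suc k \<Longrightarrow> x i = x j"
  shows "binomial_var (Suc k) x \<le> real (Suc k) / 8 * avg_sq k (diff_seq x)"
  using assms
proof (induction k arbitrary: x)
  case 0
  have "x 0 = x (Suc 0)" using 0[of 0 1] by simp
  then show ?case
    by (simp add: binomial_var_def)
next
  case (Suc k)
  let ?m = "\<lambda>x j. (x j + x (Suc j)) / (2::complex)"
  have IH: "binomial_var (Suc k) (?m x) \<le> real (Suc k) / 8 * avg_sq k (diff_seq (?m x))"
  proof (rule Suc.IH)
    fix i j assume ij: "i + j = Suc k"
    have "x i = x (Suc j)" "x (Suc i) = x j"
      using ij by (auto intro: Suc.prems)
    then show "?m x i = ?m x j" by simp
  qed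
  have "binomial_avg (Suc k) (diff_seq x) = 0"
  proof (rule binomial_avg_antisymmetric)
    fix i j assume ij: "i + j = Suc k"
    have "x i = x (Suc j)" "x (Suc i) = x j"
      using ij by (auto intro: Suc.prems)
    then show "diff_seq x i = - diff_seq x j" by simp
  qed
  \<comment> \<open>As the differences have mean zero, the plain Poincare inequality bounds their
    whole square average by second differences. So averaging shrinks the Dirichlet form at least by
    the factor k' / (k' + 1) with k' = \<open>Suc k\<close> - 1, and (k' + 1) / 8 times this factor
    plus 1 / 4 is (k' + 2) / 8.\<close>
  then have "avg_sq (Suc k) (diff_seq x) = binomial_var (Suc k) (diff_seq x)"
    by (simp only: binomial_var_def) simp
  also have "\<dots> \<le> real (Suc k) / 4 * avg_sq k (diff_seq (diff_seq x))"
    by (rule binomial_poincare)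
  also have "\<dots> = real (Suc k) * (avg_sq (Suc k) (diff_seq x) - avg_sq k (diff_seq (?m x)))"
    unfolding avg_sq_diff_mean by (simp del: binomial_avg.simps add: field_simps)
  finally show ?case
    using IH unfolding binomial_var_Suc[of "Suc k"] by (simp del: binomial_avg.simps add: field_simps)
qed

text \<open>As a form in the relative angular momentum m it has eigenvalue 0 at m = 0 and m / 2 - 1
  at m >= 1. Symmetric sequences contain even m only, so there it is nonnegative, with kernel m = 0
  and m = 2.\<close>

definition gap_form :: "nat \<Rightarrow> (nat \<Rightarrow> complex) \<Rightarrow> real" where
  "gap_form k x = real k / 8 * avg_sq (k - 1) (diff_seq x) - binomial_var k x"

lemma gap_form_nonneg:
  assumes "\<And>i j. i + j = k \<Longrightarrow> x i = x j"
  shows "0 \<le> gap_form k x"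
proof (cases k)
  case 0
  then show ?thesis by (simp add: gap_form_def binomial_var_def)
next
  case (Suc n)
  then show ?thesis
    using binomial_poincare_symmetric[of n x] assms by (simp add: gap_form_def)
qed

lemma gap_form_le: "gap_form k x \<le> real k / 8 * avg_sq (k - 1) (diff_seq x)"
  using binomial_var_nonneg[of k x] by (simp add: gap_form_def)

lemma avg_sq_parallelogram:
  "avg_sq k (\<lambda>j. x j + y j) + avg_sq k (\<lambda>j. x j - y j) = 2 * avg_sq k x + 2 * avg_sq k y"
  unfolding binomial_avg_add[symmetric] binomial_avg_cmult[symmetric] parallelogram_cmod ..

text \<open>Parallelogram identity for the quadratic form, with the term at x + y dropped; symmetry
  makes that term nonnegative.\<close>

lemma gap_form_diff_le:
  assumes "\<And>i j. i + j = k \<Longrightarrow> x i = x j" "\<And>i j. i + j = k \<Longrightarrow> y i = y j"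
  shows "gap_form k (\<lambda>j. x j - y j) \<le> 2 * gap_form k x + 2 * gap_form k y"
proof -
  have "0 \<le> gap_form k (\<lambda>j. x j + y j)"
    using assms by (intro gap_form_nonneg) metis
  moreover have "gap_form k (\<lambda>j. x j + y j) + gap_form k (\<lambda>j. x j - y j) =
      2 * gap_form k x + 2 * gap_form k y"
  proof -
    have d: "x (Suc j) + y (Suc j) - (x j + y j) = diff_seq x j + diff_seq y j"
            "x (Suc j) - y (Suc j) - (x j - y j) = diff_seq x j - diff_seq y j" for j
      by auto
    have "real k / 8 * (avg_sq (k - 1) (\<lambda>j. diff_seq x j + diff_seq y j) +
                        avg_sq (k - 1) (\<lambda>j. diff_seq x j - diff_seq y j)) =
          real k / 8 * (2 * avg_sq (k - 1) (diff_seq x) + 2 * avg_sq (k - 1) (diff_seq y))"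
      by (simp only: avg_sq_parallelogram)
    then show ?thesis
      using avg_sq_parallelogram[of k x y]
        parallelogram_cmod[of "binomial_avg k x" "binomial_avg k y"]
      unfolding gap_form_def binomial_var_def binomial_avg_add binomial_avg_diff d
      by (simp only: algebra_simps)
  qed
  ultimately show ?thesis by linarith
qed

text \<open>Second differences represent m (m - 1), so this is m (m - 1) <= m + k (m - 2) for even m
  from 2 to k, and both sides vanish at m = 0. It comes from the symmetric Poincare inequality for
  the once averaged sequence.\<close>

lemma second_difference_bound:
  assumes "\<And>i j. i + j = k \<Longrightarrow> x i = x j"
  shows "real k * (real k - 1) / 16 * avg_sq (k - 2) (diff_seq (diff_seq x))
       \<le> real k / 4 * avg_sq (k - 1) (diff_seq x) + 2 * real k * gap_form k x"
proof (cases "k < 2")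
  \<comment> \<open>The subtraction k - 2 truncates here, but the factor k (k - 1) is 0.\<close>
  case True
  have "0 \<le> real k / 4 * avg_sq (k - 1) (diff_seq x)"
    by (simp add: binomial_avg_nonneg)
  with True gap_form_nonneg[of k x, OF assms] show ?thesis
    by (auto simp: less_2_cases_iff)
next
  case False
  define n where "n = k - 2"
  have k: "k = Suc (Suc n)" using False by (simp add: n_def)
  let ?m = "\<lambda>x j. (x j + x (Suc j)) / (2::complex)"
  have "binomial_var (Suc n) (?m x) \<le> real (Suc n) / 8 * avg_sq n (diff_seq (?m x))"
  proof (rule binomial_poincare_symmetric)
    fix i j assume ij: "i + j = Suc n"
    have "x i = x (Suc j)" "x (Suc i) = x j"
      using ij k by (auto intro: assms)
    then show "?m x i = ?m x j" by simp
  qed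
  then have *: "binomial_var (Suc n) (?m x) \<le> real (Suc n) / 8 *
      (avg_sq (Suc n) (diff_seq x) - avg_sq n (diff_seq (diff_seq x)) / 4)"
    unfolding avg_sq_diff_mean .
  have g: "gap_form k x = real k / 8 * avg_sq (Suc n) (diff_seq x)
      - (binomial_var (Suc n) (?m x) + avg_sq (Suc n) (diff_seq x) / 4)"
    unfolding gap_form_def k binomial_var_Suc[of "Suc n"] by simp
  define p where "p = avg_sq (Suc n) (diff_seq x)"
  define q where "q = avg_sq n (diff_seq (diff_seq x))"
  define v where "v = binomial_var (Suc n) (?m x)"
  have "real (Suc n) / 8 * (q / 4) \<le> gap_form k x + p / 8"
    using * g unfolding p_def[symmetric] q_def[symmetric] v_def[symmetric]
    by (simp add: k field_simps)
  then have "2 * real k * (real (Suc n) / 8 * (q / 4)) \<le> 2 * real k * (gap_form k x + p / 8)"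
    by (intro mult_left_mono) auto
  then have "real k * (real k - 1) / 16 * q \<le> real k / 4 * p + 2 * real k * gap_form k x"
    by (simp add: k field_simps)
  moreover have "k - 2 = n" "k - 1 = Suc n"
    by (simp_all add: k)
  ultimately show ?thesis
    unfolding p_def q_def by (simp only:)
qed

section \<open>Two-particle decomposition of a coefficient sequence\<close>

definition square_summable :: "(nat \<Rightarrow> complex) \<Rightarrow> bool" where
  "square_summable a \<longleftrightarrow> summable (\<lambda>n. (cmod (a n))\<^sup>2)"

definition norm_sq :: "(nat \<Rightarrow> complex) \<Rightarrow> real" where
  "norm_sq a = (\<Sum>n. (cmod (a n))\<^sup>2)"

definition inner_seq :: "(nat \<Rightarrow> complex) \<Rightarrow> (nat \<Rightarrow> complex) \<Rightarrow> complex" where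
  "inner_seq a b = (\<Sum>n. a n * cnj (b n))"

text \<open>The annihilation operator in the orthonormal basis \<open>z\<^sup>n exp (- \<bar>z\<bar>\<^sup>2 / 2) / sqrt (\<pi> n!)\<close>.\<close>

definition lower :: "(nat \<Rightarrow> complex) \<Rightarrow> nat \<Rightarrow> complex" where
  "lower a n = complex_of_real (sqrt (real (Suc n))) * a (Suc n)"

lemma summable_norm_mult:
  assumes "square_summable a" "square_summable b"
  shows "summable (\<lambda>n. cmod (a n * cnj (b n)))"
proof (rule summable_comparison_test')
  show "summable (\<lambda>n. (cmod (a n))\<^sup>2 + (cmod (b n))\<^sup>2)"
    using assms unfolding square_summable_def by (rule summable_add)
  show "norm (cmod (a n * cnj (b n))) \<le> (cmod (a n))\<^sup>2 + (cmod (b n))\<^sup>2" if "n \<ge> 0" for n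
  proof -
    have "norm (cmod (a n * cnj (b n))) = cmod (a n) * cmod (b n)" "0 \<le> cmod (a n) * cmod (b n)"
      by (simp_all add: norm_mult)
    with sum_squares_bound[of "cmod (a n)" "cmod (b n)"] show ?thesis by linarith
  qed
qed

lemma inner_seq_self:
  assumes "square_summable a"
  shows "inner_seq a a = complex_of_real (norm_sq a)"
proof -
  have "(\<lambda>n. complex_of_real ((cmod (a n))\<^sup>2)) sums complex_of_real (norm_sq a)"
    using assms unfolding square_summable_def norm_sq_def sums_of_real_iff by (rule summable_sums)
  then show ?thesis
    unfolding inner_seq_def complex_norm_square by (rule sums_unique[symmetric])
qed

lemma inner_seq_cnj:
  assumes "square_summable a" "square_summable b"
  shows "inner_seq b a = cnj (inner_seq a b)"
proof -
  have "(\<lambda>n. a n * cnj (b n)) sums inner_seq a b"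
    unfolding inner_seq_def
    by (intro summable_sums summable_norm_cancel[OF summable_norm_mult] assms)
  then have "(\<lambda>n. cnj (a n * cnj (b n))) sums cnj (inner_seq a b)"
    by (simp only: sums_cnj)
  then have "(\<lambda>n. b n * cnj (a n)) sums cnj (inner_seq a b)"
    by (simp add: mult.commute)
  then show ?thesis
    unfolding inner_seq_def[of b a] by (rule sums_unique[symmetric])
qed

lemma norm_sq_nonneg: "square_summable a \<Longrightarrow> 0 \<le> norm_sq a"
  unfolding norm_sq_def square_summable_def by (rule suminf_nonneg) auto

lemma inner_seq_product_sums:
  assumes "square_summable a" "square_summable b" "square_summable c" "square_summable d"
  shows "(\<lambda>k. \<Sum>j\<le>k. a j * cnj (b j) * (c (k - j) * cnj (d (k - j)))) sums
           (inner_seq a b * inner_seq c d)"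
  unfolding inner_seq_def
  by (rule Cauchy_product_sums) (intro summable_norm_mult assms)+

text \<open>Lagrange's identity: the squares |a_i b_j - b_i a_j|^2, grouped by i + j so that Cauchy
  products apply, sum to twice the defect. The level sums below expand in the same way.\<close>

lemma inner_seq_Cauchy_Schwarz:
  assumes "square_summable a" "square_summable b"
  shows "(cmod (inner_seq a b))\<^sup>2 \<le> norm_sq a * norm_sq b"
proof -
  have "(\<lambda>k. (\<Sum>j\<le>k. a j * cnj (a j) * (b (k - j) * cnj (b (k - j))))
           - (\<Sum>j\<le>k. a j * cnj (b j) * (b (k - j) * cnj (a (k - j))))
           - (\<Sum>j\<le>k. b j * cnj (a j) * (a (k - j) * cnj (b (k - j))))
           + (\<Sum>j\<le>k. b j * cnj (b j) * (a (k - j) * cnj (a (k - j))))) sums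
         (inner_seq a a * inner_seq b b - inner_seq a b * inner_seq b a
           - inner_seq b a * inner_seq a b + inner_seq b b * inner_seq a a)"
    by (intro sums_add sums_diff inner_seq_product_sums assms)
  also have "(\<lambda>k. (\<Sum>j\<le>k. a j * cnj (a j) * (b (k - j) * cnj (b (k - j))))
           - (\<Sum>j\<le>k. a j * cnj (b j) * (b (k - j) * cnj (a (k - j))))
           - (\<Sum>j\<le>k. b j * cnj (a j) * (a (k - j) * cnj (b (k - j))))
           + (\<Sum>j\<le>k. b j * cnj (b j) * (a (k - j) * cnj (a (k - j))))) =
      (\<lambda>k. complex_of_real (\<Sum>j\<le>k. (cmod (a j * b (k - j) - b j * a (k - j)))\<^sup>2))"
    unfolding sum.distrib[symmetric] sum_subtractf[symmetric] of_real_sum complex_norm_square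
    by (simp add: algebra_simps)
  also have "inner_seq a a * inner_seq b b - inner_seq a b * inner_seq b a
           - inner_seq b a * inner_seq a b + inner_seq b b * inner_seq a a =
      complex_of_real (2 * (norm_sq a * norm_sq b - (cmod (inner_seq a b))\<^sup>2))"
    using assms
    by (simp add: inner_seq_self inner_seq_cnj[of a b] complex_norm_square del: of_real_power)
  finally have "(\<lambda>k. \<Sum>j\<le>k. (cmod (a j * b (k - j) - b j * a (k - j)))\<^sup>2) sums
      (2 * (norm_sq a * norm_sq b - (cmod (inner_seq a b))\<^sup>2))"
    by (simp only: sums_of_real_iff)
  from sums_le[OF _ sums_zero this] have "0 \<le> 2 * (norm_sq a * norm_sq b - (cmod (inner_seq a b))\<^sup>2)"
    by (simp add: sum_nonneg)
  then show ?thesis by simp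
qed

lemma square_summable_lower:
  assumes "summable (\<lambda>n. real n * (cmod (a n))\<^sup>2)"
  shows "square_summable (lower a)" "norm_sq (lower a) = (\<Sum>n. real n * (cmod (a n))\<^sup>2)"
proof -
  have eq: "(cmod (lower a n))\<^sup>2 = real (Suc n) * (cmod (a (Suc n)))\<^sup>2" for n
    by (simp add: lower_def norm_mult power_mult_distrib del: of_nat_Suc)
  show "square_summable (lower a)"
    unfolding square_summable_def eq using assms by (subst summable_Suc_iff)
  show "norm_sq (lower a) = (\<Sum>n. real n * (cmod (a n))\<^sup>2)"
    unfolding norm_sq_def eq using suminf_split_head[OF assms] by simp
qed

section \<open>Pairs of modes of fixed total degree\<close>

definition taylor :: "(nat \<Rightarrow> complex) \<Rightarrow> nat \<Rightarrow> complex" where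
  "taylor a j = complex_of_real (sqrt (fact j)) * a j"

text \<open>Up to a constant, \<open>taylor a n\<close> is the n-th derivative at 0 of the
  holomorphic factor. The weights turn annihilation into a plain shift, so that differences of
  \<open>pair_level\<close> realise the relative annihilation operator up to normalisation.\<close>

lemma taylor_Suc: "taylor a (Suc n) = taylor (lower a) n"
  by (simp add: taylor_def lower_def real_sqrt_mult algebra_simps del: of_nat_Suc)

definition pair_level :: "(nat \<Rightarrow> complex) \<Rightarrow> nat \<Rightarrow> nat \<Rightarrow> complex" where
  "pair_level a k j = taylor a j * taylor a (k - j)"

text \<open>Cancels the binomial weight against the two factorials in \<open>pair_level\<close>, so
  that \<open>level_norm\<close> is the plain squared norm of the degree k part of the tensor
  square.\<close>

definition level_weight :: "nat \<Rightarrow> real" where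
  "level_weight k = 2 ^ k / fact k"

definition level_norm :: "(nat \<Rightarrow> complex) \<Rightarrow> nat \<Rightarrow> real" where
  "level_norm a k = level_weight k * avg_sq k (pair_level a k)"

text \<open>Constant sequences represent m = 0, so this is the degree k part of p_0.\<close>

definition level_contact :: "(nat \<Rightarrow> complex) \<Rightarrow> nat \<Rightarrow> real" where
  "level_contact a k = level_weight k * (cmod (binomial_avg k (pair_level a k)))\<^sup>2"

text \<open>Degree k part of the mean of m, the squared norm after one relative
  annihilation.\<close>

definition level_diff :: "(nat \<Rightarrow> complex) \<Rightarrow> nat \<Rightarrow> real" where
  "level_diff a k = level_weight k * (real k / 4 * avg_sq (k - 1) (diff_seq (pair_level a k)))"

text \<open>Degree k part of the mean of m (m - 1), the squared norm after two relative
  annihilations.\<close>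

definition level_diff2 :: "(nat \<Rightarrow> complex) \<Rightarrow> nat \<Rightarrow> real" where
  "level_diff2 a k = level_weight k *
     (real k * (real k - 1) / 16 * avg_sq (k - 2) (diff_seq (diff_seq (pair_level a k))))"

definition level_gap :: "(nat \<Rightarrow> complex) \<Rightarrow> nat \<Rightarrow> real" where
  "level_gap a k = level_weight k * gap_form k (pair_level a k)"

lemma level_weight_pos: "0 < level_weight k"
  by (simp add: level_weight_def)

lemma pair_level_symmetric: "i + j = k \<Longrightarrow> pair_level a k i = pair_level a k j"
  by (auto simp: pair_level_def)

lemma level_gap_eq: "level_gap a k = level_diff a k / 2 - level_norm a k + level_contact a k"
  by (simp add: level_gap_def gap_form_def binomial_var_def level_diff_def level_norm_def
      level_contact_def algebra_simps)

lemma level_gap_nonneg: "0 \<le> level_gap a k"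
  unfolding level_gap_def
  by (intro mult_nonneg_nonneg gap_form_nonneg less_imp_le[OF level_weight_pos])
     (rule pair_level_symmetric)

lemma level_gap_le: "level_gap a k \<le> level_diff a k / 2"
proof -
  have "level_weight k * gap_form k (pair_level a k) \<le>
      level_weight k * (real k / 8 * avg_sq (k - 1) (diff_seq (pair_level a k)))"
    by (intro mult_left_mono gap_form_le less_imp_le[OF level_weight_pos])
  then show ?thesis
    by (simp add: level_gap_def level_diff_def)
qed

lemma level_contact_nonneg: "0 \<le> level_contact a k"
  unfolding level_contact_def using level_weight_pos[of k] by simp

lemma level_contact_le: "level_contact a k \<le> level_norm a k"
proof -
  have "level_weight k * (cmod (binomial_avg k (pair_level a k)))\<^sup>2 \<le>
      level_weight k * avg_sq k (pair_level a k)"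
    using binomial_var_nonneg[of k "pair_level a k"]
    by (intro mult_left_mono less_imp_le[OF level_weight_pos]) (simp add: binomial_var_def)
  then show ?thesis
    by (simp add: level_contact_def level_norm_def)
qed

lemma level_diff2_le: "level_diff2 a k \<le> level_diff a k + 2 * real k * level_gap a k"
proof -
  have "level_weight k *
      (real k * (real k - 1) / 16 * avg_sq (k - 2) (diff_seq (diff_seq (pair_level a k)))) \<le>
      level_weight k * (real k / 4 * avg_sq (k - 1) (diff_seq (pair_level a k)) +
        2 * real k * gap_form k (pair_level a k))"
    by (intro mult_left_mono second_difference_bound less_imp_le[OF level_weight_pos])
       (rule pair_level_symmetric)
  then show ?thesis
    by (simp add: level_diff2_def level_diff_def level_gap_def algebra_simps)
qed

lemma avg_sq_factorial:
  assumes "\<And>j. j \<le> k \<Longrightarrow>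
    y j = complex_of_real (sqrt (fact j)) * complex_of_real (sqrt (fact (k - j))) * t j"
  shows "avg_sq k y = fact k / 2 ^ k * (\<Sum>j\<le>k. (cmod (t j))\<^sup>2)"
proof -
  have "real (k choose j) * (cmod (y j))\<^sup>2 = fact k * (cmod (t j))\<^sup>2" if "j \<le> k" for j
  proof -
    have "real (k choose j) * (fact j * fact (k - j)) = fact k"
      using binomial_fact_lemma[OF that] by (metis of_nat_fact of_nat_mult mult.commute)
    then show ?thesis
      by (simp add: assms[OF that] norm_mult power_mult_distrib)
  qed
  then have "(\<Sum>j\<le>k. real (k choose j) * (cmod (y j))\<^sup>2) = (\<Sum>j\<le>k. fact k * (cmod (t j))\<^sup>2)"
    by (intro sum.cong) auto
  then show ?thesis
    by (simp add: binomial_avg_eq_sum sum_distrib_left[symmetric])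
qed

lemma level_norm_eq: "level_norm a k = (\<Sum>j\<le>k. (cmod (a j * a (k - j)))\<^sup>2)"
proof -
  have "avg_sq k (pair_level a k) = fact k / 2 ^ k * (\<Sum>j\<le>k. (cmod (a j * a (k - j)))\<^sup>2)"
    by (rule avg_sq_factorial) (simp add: pair_level_def taylor_def)
  then show ?thesis
    by (simp add: level_norm_def level_weight_def)
qed

lemma level_diff_Suc:
  "level_diff a (Suc k) = (\<Sum>j\<le>k. (cmod (lower a j * a (k - j) - a j * lower a (k - j)))\<^sup>2) / 2"
proof -
  have "avg_sq k (diff_seq (pair_level a (Suc k))) =
      fact k / 2 ^ k * (\<Sum>j\<le>k. (cmod (lower a j * a (k - j) - a j * lower a (k - j)))\<^sup>2)"
    by (rule avg_sq_factorial)
       (simp add: pair_level_def taylor_Suc Suc_diff_le, simp add: taylor_def algebra_simps)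
  then show ?thesis
    by (simp add: level_diff_def level_weight_def divide_simps del: of_nat_Suc) (simp add: mult_ac)
qed

lemma level_diff2_Suc_Suc:
  "level_diff2 a (Suc (Suc k)) = (\<Sum>j\<le>k. (cmod (lower (lower a) j * a (k - j)
      - 2 * (lower a j * lower a (k - j)) + a j * lower (lower a) (k - j)))\<^sup>2) / 4"
proof -
  have "avg_sq k (diff_seq (diff_seq (pair_level a (Suc (Suc k))))) =
      fact k / 2 ^ k * (\<Sum>j\<le>k. (cmod (lower (lower a) j * a (k - j)
      - 2 * (lower a j * lower a (k - j)) + a j * lower (lower a) (k - j)))\<^sup>2)"
    by (rule avg_sq_factorial)
       (simp add: pair_level_def taylor_Suc Suc_diff_le, simp add: taylor_def algebra_simps)
  moreover have "real (Suc (Suc k)) - 1 = real (Suc k)" by simp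
  ultimately show ?thesis
    unfolding level_diff2_def level_weight_def
    by (simp only: diff_Suc_Suc diff_zero numeral_2_eq_2) (simp add: divide_simps del: of_nat_Suc)
qed

lemma level_norm_sums:
  assumes "square_summable a"
  shows "level_norm a sums (norm_sq a)\<^sup>2"
proof -
  have "(\<lambda>k. \<Sum>j\<le>k. (cmod (a j))\<^sup>2 * (cmod (a (k - j)))\<^sup>2) sums (norm_sq a * norm_sq a)"
    using assms unfolding norm_sq_def square_summable_def by (intro Cauchy_product_sums) auto
  then show ?thesis
    by (simp add: level_norm_eq[abs_def] norm_mult power_mult_distrib power2_eq_square mult_ac)
qed

text \<open>The squares in \<open>level_diff_Suc\<close> expand into four Cauchy products: the
  diagonal ones give the product of the norms, the cross terms the subtracted inner product.\<close>

lemma level_diff_sums: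
  assumes "square_summable a" "square_summable (lower a)"
  shows "level_diff a sums
    (norm_sq a * norm_sq (lower a) - (cmod (inner_seq (lower a) a))\<^sup>2)"
proof -
  let ?b = "lower a"
  have "(\<lambda>k. (\<Sum>j\<le>k. ?b j * cnj (?b j) * (a (k - j) * cnj (a (k - j))))
           - (\<Sum>j\<le>k. ?b j * cnj (a j) * (a (k - j) * cnj (?b (k - j))))
           - (\<Sum>j\<le>k. a j * cnj (?b j) * (?b (k - j) * cnj (a (k - j))))
           + (\<Sum>j\<le>k. a j * cnj (a j) * (?b (k - j) * cnj (?b (k - j))))) sums
         (inner_seq ?b ?b * inner_seq a a - inner_seq ?b a * inner_seq a ?b
           - inner_seq a ?b * inner_seq ?b a + inner_seq a a * inner_seq ?b ?b)"
    by (intro sums_add sums_diff inner_seq_product_sums assms)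
  also have "(\<lambda>k. (\<Sum>j\<le>k. ?b j * cnj (?b j) * (a (k - j) * cnj (a (k - j))))
           - (\<Sum>j\<le>k. ?b j * cnj (a j) * (a (k - j) * cnj (?b (k - j))))
           - (\<Sum>j\<le>k. a j * cnj (?b j) * (?b (k - j) * cnj (a (k - j))))
           + (\<Sum>j\<le>k. a j * cnj (a j) * (?b (k - j) * cnj (?b (k - j))))) =
      (\<lambda>k. complex_of_real (\<Sum>j\<le>k. (cmod (?b j * a (k - j) - a j * ?b (k - j)))\<^sup>2))"
    unfolding sum.distrib[symmetric] sum_subtractf[symmetric] of_real_sum complex_norm_square
    by (simp add: algebra_simps)
  also have "inner_seq ?b ?b * inner_seq a a - inner_seq ?b a * inner_seq a ?b
           - inner_seq a ?b * inner_seq ?b a + inner_seq a a * inner_seq ?b ?b =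
      complex_of_real (2 * (norm_sq a * norm_sq ?b - (cmod (inner_seq ?b a))\<^sup>2))"
    using assms
    by (simp add: inner_seq_self inner_seq_cnj[of ?b a] complex_norm_square del: of_real_power)
  finally have "(\<lambda>k. \<Sum>j\<le>k. (cmod (?b j * a (k - j) - a j * ?b (k - j)))\<^sup>2) sums
      (2 * (norm_sq a * norm_sq ?b - (cmod (inner_seq ?b a))\<^sup>2))"
    by (simp only: sums_of_real_iff)
  then have "(\<lambda>k. level_diff a (Suc k)) sums
      (2 * (norm_sq a * norm_sq ?b - (cmod (inner_seq ?b a))\<^sup>2) / 2)"
    unfolding level_diff_Suc by (rule sums_divide)
  then have "level_diff a sums
      (2 * (norm_sq a * norm_sq ?b - (cmod (inner_seq ?b a))\<^sup>2) / 2 + level_diff a 0)"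
    by (rule sums_Suc)
  then show ?thesis by (simp add: level_diff_def diff_divide_distrib)
qed

text \<open>The same expansion for the three-term square. Square summability of
  \<open>lower (lower a)\<close> amounts to a finite second moment of n, which finite momentum does
  not provide; this is the reason for damping.\<close>

lemma level_diff2_sums:
  assumes "square_summable a" "square_summable (lower a)" "square_summable (lower (lower a))"
  shows "level_diff2 a sums
    ((norm_sq a * norm_sq (lower (lower a)) + (cmod (inner_seq (lower (lower a)) a))\<^sup>2) / 2
      + (norm_sq (lower a))\<^sup>2
      - 2 * Re (inner_seq (lower (lower a)) (lower a) * inner_seq a (lower a)))"
proof -
  let ?b = "lower a" and ?c = "lower (lower a)"
  let ?S = "\<lambda>p q r s k. (\<Sum>j\<le>k. p j * cnj (q j) * (r (k - j) * cnj (s (k - j))))"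
  let ?z = "inner_seq ?c ?b * inner_seq a ?b"
  let ?L = "(norm_sq a * norm_sq ?c + (cmod (inner_seq ?c a))\<^sup>2) / 2 + (norm_sq ?b)\<^sup>2 - 2 * Re ?z"
  have "(\<lambda>k. ?S ?c ?c a a k + ?S a a ?c ?c k + ?S ?c a a ?c k + ?S a ?c ?c a k
      + 4 * ?S ?b ?b ?b ?b k
      - 2 * (?S ?c ?b a ?b k + ?S ?b ?c ?b a k + ?S a ?b ?c ?b k + ?S ?b a ?b ?c k)) sums
      (inner_seq ?c ?c * inner_seq a a + inner_seq a a * inner_seq ?c ?c
      + inner_seq ?c a * inner_seq a ?c + inner_seq a ?c * inner_seq ?c a
      + 4 * (inner_seq ?b ?b * inner_seq ?b ?b)
      - 2 * (inner_seq ?c ?b * inner_seq a ?b + inner_seq ?b ?c * inner_seq ?b a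
         + inner_seq a ?b * inner_seq ?c ?b + inner_seq ?b a * inner_seq ?b ?c))"
    by (intro sums_add sums_diff sums_mult inner_seq_product_sums assms)
  also have "(\<lambda>k. ?S ?c ?c a a k + ?S a a ?c ?c k + ?S ?c a a ?c k + ?S a ?c ?c a k
      + 4 * ?S ?b ?b ?b ?b k
      - 2 * (?S ?c ?b a ?b k + ?S ?b ?c ?b a k + ?S a ?b ?c ?b k + ?S ?b a ?b ?c k)) =
      (\<lambda>k. complex_of_real (\<Sum>j\<le>k. (cmod (?c j * a (k - j)
         - 2 * (?b j * ?b (k - j)) + a j * ?c (k - j)))\<^sup>2))"
    unfolding sum.distrib[symmetric] sum_subtractf[symmetric] sum_distrib_left of_real_sum
      complex_norm_square
    by (simp add: algebra_simps)
  also have "inner_seq ?c ?c * inner_seq a a + inner_seq a a * inner_seq ?c ?c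
      + inner_seq ?c a * inner_seq a ?c + inner_seq a ?c * inner_seq ?c a
      + 4 * (inner_seq ?b ?b * inner_seq ?b ?b)
      - 2 * (inner_seq ?c ?b * inner_seq a ?b + inner_seq ?b ?c * inner_seq ?b a
         + inner_seq a ?b * inner_seq ?c ?b + inner_seq ?b a * inner_seq ?b ?c) =
      complex_of_real (4 * ?L)"
  proof -
    have cnj: "inner_seq ?b ?c * inner_seq ?b a = cnj ?z"
      using assms by (simp add: inner_seq_cnj[of ?c ?b] inner_seq_cnj[of a ?b])
    have "inner_seq ?c ?b * inner_seq a ?b + inner_seq ?b ?c * inner_seq ?b a
         + inner_seq a ?b * inner_seq ?c ?b + inner_seq ?b a * inner_seq ?b ?c =
         2 * (?z + cnj ?z)"
      unfolding cnj[symmetric] by (simp add: algebra_simps)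
    then have *: "inner_seq ?c ?b * inner_seq a ?b + inner_seq ?b ?c * inner_seq ?b a
         + inner_seq a ?b * inner_seq ?c ?b + inner_seq ?b a * inner_seq ?b ?c =
         complex_of_real (4 * Re ?z)"
      unfolding complex_add_cnj by simp
    have norm: "w * cnj w = complex_of_real (cmod w) * complex_of_real (cmod w)" for w
      using complex_norm_square[of w] by (simp add: power2_eq_square)
    show ?thesis
      unfolding *
      using assms
      by (simp add: inner_seq_self inner_seq_cnj[of ?c a] norm power2_eq_square
          algebra_simps add_divide_distrib del: of_real_power times_complex.sel)
  qed
  finally have "(\<lambda>k. \<Sum>j\<le>k. (cmod (?c j * a (k - j)
         - 2 * (?b j * ?b (k - j)) + a j * ?c (k - j)))\<^sup>2) sums (4 * ?L)"
    by (simp only: sums_of_real_iff)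
  then have "(\<lambda>k. level_diff2 a (Suc (Suc k))) sums (4 * ?L / 4)"
    unfolding level_diff2_Suc_Suc by (rule sums_divide)
  then have "level_diff2 a sums (4 * ?L / 4 + level_diff2 a (Suc 0) + level_diff2 a 0)"
    by (intro sums_Suc)
  moreover have "level_diff2 a 0 = 0" "level_diff2 a (Suc 0) = 0"
    by (simp_all add: level_diff2_def)
  moreover have "4 * ?L / 4 = ?L"
    by (rule nonzero_mult_div_cancel_left) simp
  ultimately show ?thesis by (simp only: add_0_right)
qed

section \<open>The excess energy and damping\<close>

definition contact_energy :: "(nat \<Rightarrow> complex) \<Rightarrow> real" where
  "contact_energy a = suminf (level_contact a)"

definition momentum :: "(nat \<Rightarrow> complex) \<Rightarrow> real" where
  "momentum a = (\<Sum>n. real n * (cmod (a n))\<^sup>2)"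

definition finite_momentum :: "(nat \<Rightarrow> complex) \<Rightarrow> bool" where
  "finite_momentum a \<longleftrightarrow> square_summable a \<and> summable (\<lambda>n. real n * (cmod (a n))\<^sup>2)"

definition excess :: "(nat \<Rightarrow> complex) \<Rightarrow> real" where
  "excess a = contact_energy a + momentum a / 2 - 1"

lemma finite_momentumD:
  assumes "finite_momentum a"
  shows "square_summable a" "square_summable (lower a)" "norm_sq (lower a) = momentum a"
  using assms square_summable_lower[of a] by (auto simp: finite_momentum_def momentum_def)

lemma summable_level_contact:
  assumes "square_summable a"
  shows "summable (level_contact a)"
  using sums_summable[OF level_norm_sums[OF assms]]
  by (rule summable_comparison_test') (simp add: level_contact_nonneg level_contact_le)

lemma contact_energy_nonneg: "square_summable a \<Longrightarrow> 0 \<le> contact_energy a"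
  unfolding contact_energy_def
  by (intro suminf_nonneg summable_level_contact) (auto simp: level_contact_nonneg)

lemma momentum_nonneg: "finite_momentum a \<Longrightarrow> 0 \<le> momentum a"
  using finite_momentumD[of a] norm_sq_nonneg[of "lower a"] by simp

lemma level_gap_sums:
  assumes "finite_momentum a"
  shows "level_gap a sums ((norm_sq a * momentum a - (cmod (inner_seq (lower a) a))\<^sup>2) / 2
    - (norm_sq a)\<^sup>2 + contact_energy a)"
  unfolding level_gap_eq[abs_def] contact_energy_def finite_momentumD(3)[OF assms, symmetric]
  by (intro sums_add sums_diff sums_divide summable_sums summable_level_contact
      level_norm_sums level_diff_sums finite_momentumD assms)

lemma excess_eq:
  assumes "finite_momentum a" "norm_sq a = 1"
  shows "excess a = (cmod (inner_seq (lower a) a))\<^sup>2 / 2 + suminf (level_gap a)"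
  using sums_unique[OF level_gap_sums[OF assms(1)]] assms(2)
  by (simp add: excess_def field_simps)

lemma suminf_level_gap_nonneg: "finite_momentum a \<Longrightarrow> 0 \<le> suminf (level_gap a)"
  by (intro suminf_nonneg sums_summable[OF level_gap_sums] level_gap_nonneg)

lemma excess_nonneg:
  assumes "finite_momentum a" "norm_sq a = 1"
  shows "0 \<le> excess a"
  using suminf_level_gap_nonneg[OF assms(1)] by (simp add: excess_eq assms)

section \<open>Damped coefficients\<close>

definition damp :: "real \<Rightarrow> (nat \<Rightarrow> complex) \<Rightarrow> nat \<Rightarrow> complex" where
  "damp r a n = complex_of_real (r ^ n) * a n"

lemma cmod_damp: "(cmod (damp r a n))\<^sup>2 = (r\<^sup>2) ^ n * (cmod (a n))\<^sup>2"
proof -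
  have "(cmod (damp r a n))\<^sup>2 = (r ^ n)\<^sup>2 * (cmod (a n))\<^sup>2"
    unfolding damp_def norm_mult norm_of_real power_mult_distrib power2_abs ..
  then show ?thesis
    by (simp add: mult.commute flip: power_mult)
qed

lemma lower_damp: "lower (damp r a) n = complex_of_real (r ^ Suc n) * lower a n"
  by (simp add: lower_def damp_def)

lemma cmod_scaled_power: "(cmod (complex_of_real (r ^ n) * z))\<^sup>2 = (r\<^sup>2) ^ n * (cmod z)\<^sup>2"
  using cmod_damp[of r "\<lambda>_. z" n] by (simp add: damp_def)

text \<open>All pairs of total degree k acquire the same factor r^k, so damping acts on each level
  as a scalar and the levelwise inequalities survive. A sharp cutoff of high modes would destroy
  this.\<close>

lemma level_norm_damp: "level_norm (damp r a) k = (r\<^sup>2) ^ k * level_norm a k"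
proof -
  have "damp r a j * damp r a (k - j) = complex_of_real (r ^ k) * (a j * a (k - j))" if "j \<le> k" for j
  proof -
    have "complex_of_real r ^ k = complex_of_real r ^ j * complex_of_real r ^ (k - j)"
      using that by (simp flip: power_add)
    then show ?thesis by (simp add: damp_def)
  qed
  then have "(cmod (damp r a j * damp r a (k - j)))\<^sup>2 = (r\<^sup>2) ^ k * (cmod (a j * a (k - j)))\<^sup>2"
    if "j \<le> k" for j
    using that by (simp only: cmod_scaled_power)
  then show ?thesis
    by (simp add: level_norm_eq sum_distrib_left)
qed

lemma level_diff_damp: "level_diff (damp r a) k = (r\<^sup>2) ^ k * level_diff a k"
proof (cases k)
  case 0
  then show ?thesis by (simp add: level_diff_def)
next
  case (Suc n)
  have "lower (damp r a) j * damp r a (n - j) - damp r a j * lower (damp r a) (n - j) =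
      complex_of_real (r ^ Suc n) * (lower a j * a (n - j) - a j * lower a (n - j))"
    if "j \<le> n" for j
  proof -
    have "complex_of_real r ^ n = complex_of_real r ^ j * complex_of_real r ^ (n - j)"
      using that by (simp flip: power_add)
    then show ?thesis
      by (simp add: lower_damp damp_def algebra_simps)
  qed
  then have "(cmod (lower (damp r a) j * damp r a (n - j) - damp r a j * lower (damp r a) (n - j)))\<^sup>2 =
      (r\<^sup>2) ^ Suc n * (cmod (lower a j * a (n - j) - a j * lower a (n - j)))\<^sup>2" if "j \<le> n" for j
    using that by (simp only: cmod_scaled_power)
  then show ?thesis
    by (simp add: Suc level_diff_Suc sum_distrib_left)
qed

lemma level_diff2_damp: "level_diff2 (damp r a) k = (r\<^sup>2) ^ k * level_diff2 a k"
proof (cases "k < 2")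
  case True
  then show ?thesis by (auto simp: level_diff2_def less_2_cases_iff)
next
  case False
  define n where "n = k - 2"
  have k: "k = Suc (Suc n)" using False by (simp add: n_def)
  have ll: "lower (lower (damp r a)) j = complex_of_real (r ^ Suc (Suc j)) * lower (lower a) j" for j
    by (simp add: lower_def damp_def)
  have "lower (lower (damp r a)) j * damp r a (n - j)
      - 2 * (lower (damp r a) j * lower (damp r a) (n - j))
      + damp r a j * lower (lower (damp r a)) (n - j) =
      complex_of_real (r ^ Suc (Suc n)) * (lower (lower a) j * a (n - j)
      - 2 * (lower a j * lower a (n - j)) + a j * lower (lower a) (n - j))"
    if "j \<le> n" for j
  proof -
    have "complex_of_real r ^ n = complex_of_real r ^ j * complex_of_real r ^ (n - j)"
      using that by (simp flip: power_add)
    then show ?thesis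
      by (simp add: ll lower_damp damp_def algebra_simps)
  qed
  then have "(cmod (lower (lower (damp r a)) j * damp r a (n - j)
      - 2 * (lower (damp r a) j * lower (damp r a) (n - j))
      + damp r a j * lower (lower (damp r a)) (n - j)))\<^sup>2 =
      (r\<^sup>2) ^ Suc (Suc n) * (cmod (lower (lower a) j * a (n - j)
      - 2 * (lower a j * lower a (n - j)) + a j * lower (lower a) (n - j)))\<^sup>2"
    if "j \<le> n" for j
    using that by (simp only: cmod_scaled_power)
  then show ?thesis
    by (simp add: k level_diff2_Suc_Suc sum_distrib_left)
qed

lemma one_minus_power_le:
  fixes q :: real
  assumes "0 \<le> q" "q \<le> 1"
  shows "1 - q ^ n \<le> real n * (1 - q)"
  using Bernoulli_inequality[of "q - 1" n] assms by (simp add: algebra_simps)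

text \<open>n copies of q^n are at most a geometric sum. This caps the factor k of
  \<open>level_diff2_le\<close> on damped levels.\<close>

lemma linear_times_power_le:
  fixes q :: real
  assumes "0 \<le> q" "q < 1"
  shows "real n * q ^ n \<le> 1 / (1 - q)"
proof -
  have "real n * q ^ n = (\<Sum>i<n. q ^ n)" by simp
  also have "\<dots> \<le> (\<Sum>i<n. q ^ i)"
    using assms by (intro sum_mono power_decreasing) auto
  also have "\<dots> = (1 - q ^ n) / (1 - q)"
    using assms by (simp add: sum_gp_strict)
  also have "\<dots> \<le> 1 / (1 - q)"
    using assms by (intro divide_right_mono) auto
  finally show ?thesis .
qed

context
  fixes a :: "nat \<Rightarrow> complex" and r q :: real
  assumes fm: "finite_momentum a" and r: "0 < r" "r < 1"
  defines "q \<equiv> r\<^sup>2"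
begin

lemma q_bounds: "0 < q" "q < 1"
  using r by (auto simp: q_def power_less_one_iff)

lemma q_power_le: "q ^ n \<le> 1"
  using q_bounds by (simp add: power_le_one)

lemma cmod_damp_le: "(cmod (damp r a n))\<^sup>2 \<le> (cmod (a n))\<^sup>2"
  unfolding cmod_damp q_def[symmetric]
  using q_bounds q_power_le by (intro mult_left_le_one_le) auto

lemma damp_finite_momentum: "finite_momentum (damp r a)"
  unfolding finite_momentum_def square_summable_def
proof
  have a: "summable (\<lambda>n. (cmod (a n))\<^sup>2)" "summable (\<lambda>n. real n * (cmod (a n))\<^sup>2)"
    using fm by (auto simp: finite_momentum_def square_summable_def)
  show "summable (\<lambda>n. (cmod (damp r a n))\<^sup>2)"
    using a(1) by (rule summable_comparison_test') (simp add: cmod_damp_le)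
  show "summable (\<lambda>n. real n * (cmod (damp r a n))\<^sup>2)"
    using a(2) by (rule summable_comparison_test') (simp add: cmod_damp_le mult_left_mono)
qed

lemma summable_lower_damp: "summable (\<lambda>n. real n * (cmod (lower (damp r a) n))\<^sup>2)"
proof (rule summable_comparison_test'[where N = 0])
  show "summable (\<lambda>n. 1 / (1 - q) * (cmod (lower a n))\<^sup>2)"
    using finite_momentumD(2)[OF fm] unfolding square_summable_def by (rule summable_mult)
  fix n
  have "real n * q ^ Suc n \<le> real n * q ^ n"
    using q_bounds by (intro mult_left_mono power_decreasing) auto
  also have "\<dots> \<le> 1 / (1 - q)"
    using q_bounds by (intro linear_times_power_le) auto
  finally have "real n * q ^ Suc n * (cmod (lower a n))\<^sup>2 \<le> 1 / (1 - q) * (cmod (lower a n))\<^sup>2"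
    by (rule mult_right_mono) simp
  moreover have "norm (real n * (cmod (lower (damp r a) n))\<^sup>2) = real n * (cmod (lower (damp r a) n))\<^sup>2"
    by simp
  ultimately show "norm (real n * (cmod (lower (damp r a) n))\<^sup>2) \<le> 1 / (1 - q) * (cmod (lower a n))\<^sup>2"
    unfolding lower_damp cmod_scaled_power q_def[symmetric] by (simp only: mult.assoc)
qed

lemma norm_sq_damp_le: "norm_sq (damp r a) \<le> norm_sq a"
  unfolding norm_sq_def
proof (rule suminf_le)
  show "(cmod (damp r a n))\<^sup>2 \<le> (cmod (a n))\<^sup>2" for n
    by (rule cmod_damp_le)
qed (use fm damp_finite_momentum in \<open>auto simp: finite_momentum_def square_summable_def\<close>)

lemma momentum_damp_le: "momentum (damp r a) \<le> momentum a"
  unfolding momentum_def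
proof (rule suminf_le)
  show "real n * (cmod (damp r a n))\<^sup>2 \<le> real n * (cmod (a n))\<^sup>2" for n
    by (simp add: cmod_damp_le mult_left_mono)
qed (use fm damp_finite_momentum in \<open>auto simp: finite_momentum_def square_summable_def\<close>)

text \<open>Bernoulli's inequality 1 - q^n <= n (1 - q) lets the momentum pay for the lost
  mass.\<close>

lemma norm_sq_damp_ge: "norm_sq a - (1 - q) * momentum a \<le> norm_sq (damp r a)"
proof -
  have s: "(\<lambda>n. (cmod (a n))\<^sup>2 - (1 - q) * (real n * (cmod (a n))\<^sup>2)) sums
      (norm_sq a - (1 - q) * momentum a)"
    using fm unfolding norm_sq_def momentum_def finite_momentum_def square_summable_def
    by (intro sums_diff sums_mult summable_sums) auto
  have s': "(\<lambda>n. (cmod (damp r a n))\<^sup>2) sums norm_sq (damp r a)"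
    using damp_finite_momentum unfolding norm_sq_def finite_momentum_def square_summable_def
    by (intro summable_sums) auto
  show ?thesis
  proof (rule sums_le[OF _ s s'])
    fix n
    have "(1 - real n * (1 - q)) * (cmod (a n))\<^sup>2 \<le> q ^ n * (cmod (a n))\<^sup>2"
      using one_minus_power_le[of q n] q_bounds by (intro mult_right_mono) auto
    then show "(cmod (a n))\<^sup>2 - (1 - q) * (real n * (cmod (a n))\<^sup>2) \<le> (cmod (damp r a n))\<^sup>2"
      unfolding cmod_damp q_def[symmetric] by (simp add: algebra_simps)
  qed
qed

text \<open>Bernoulli's inequality would cost a higher moment here. Instead the identity for
  \<open>level_gap\<close> bounds \<open>level_diff\<close> by twice \<open>level_norm\<close> plus
  twice \<open>level_gap\<close>, so the loss is paid by lost mass and by the gap.\<close>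

lemma level_diff_damp_loss:
  "suminf (level_diff a) - suminf (level_diff (damp r a)) \<le>
     2 * ((norm_sq a)\<^sup>2 - (norm_sq (damp r a))\<^sup>2) + 2 * suminf (level_gap a)"
proof -
  note fm' = damp_finite_momentum
  have d: "(\<lambda>k. level_diff a k - level_diff (damp r a) k) sums
      (suminf (level_diff a) - suminf (level_diff (damp r a)))"
    by (intro sums_diff summable_sums sums_summable[OF level_diff_sums] finite_momentumD fm fm')
  have e: "(\<lambda>k. 2 * (level_norm a k - level_norm (damp r a) k) + 2 * level_gap a k) sums
      (2 * ((norm_sq a)\<^sup>2 - (norm_sq (damp r a))\<^sup>2) + 2 * suminf (level_gap a))"
    by (intro sums_add sums_mult sums_diff level_norm_sums finite_momentumD fm fm'
        summable_sums sums_summable[OF level_gap_sums])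
  show ?thesis
  proof (rule sums_le[OF _ d e])
    fix k
    have "level_diff a k = 2 * level_norm a k + 2 * level_gap a k - 2 * level_contact a k"
      by (simp add: level_gap_eq)
    then have "level_diff a k \<le> 2 * level_norm a k + 2 * level_gap a k"
      using level_contact_nonneg[of a k] by linarith
    then have "(1 - q ^ k) * level_diff a k \<le> (1 - q ^ k) * (2 * level_norm a k + 2 * level_gap a k)"
      using q_power_le by (intro mult_left_mono) auto
    also have "\<dots> \<le> (1 - q ^ k) * (2 * level_norm a k) + 2 * level_gap a k"
    proof -
      have "0 \<le> q ^ k * (2 * level_gap a k)"
        using q_bounds level_gap_nonneg[of a k] by simp
      then show ?thesis by (simp add: algebra_simps)
    qed
    finally show "level_diff a k - level_diff (damp r a) k \<le>
        2 * (level_norm a k - level_norm (damp r a) k) + 2 * level_gap a k"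
      unfolding level_diff_damp level_norm_damp q_def[symmetric] by (simp add: algebra_simps)
  qed
qed

lemma level_diff2_damp_le:
  "suminf (level_diff2 (damp r a)) \<le>
     suminf (level_diff (damp r a)) + 2 / (1 - q) * suminf (level_gap a)"
proof -
  note fm' = damp_finite_momentum
  have d: "level_diff2 (damp r a) sums suminf (level_diff2 (damp r a))"
    by (intro summable_sums sums_summable[OF level_diff2_sums] finite_momentumD fm'
        square_summable_lower summable_lower_damp)
  have e: "(\<lambda>k. level_diff (damp r a) k + 2 / (1 - q) * level_gap a k) sums
      (suminf (level_diff (damp r a)) + 2 / (1 - q) * suminf (level_gap a))"
    by (intro sums_add sums_mult finite_momentumD fm fm' summable_sums
        sums_summable[OF level_gap_sums] sums_summable[OF level_diff_sums])
  show ?thesis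
  proof (rule sums_le[OF _ d e])
    fix k
    have "q ^ k * level_diff2 a k \<le> q ^ k * (level_diff a k + 2 * real k * level_gap a k)"
      using q_bounds by (intro mult_left_mono level_diff2_le) auto
    also have "\<dots> = q ^ k * level_diff a k + 2 * (real k * q ^ k) * level_gap a k"
      by (simp add: algebra_simps)
    also have "\<dots> \<le> q ^ k * level_diff a k + 2 * (1 / (1 - q)) * level_gap a k"
      using q_bounds
      by (intro add_left_mono mult_right_mono mult_left_mono linear_times_power_le level_gap_nonneg) auto
    finally show "level_diff2 (damp r a) k \<le> level_diff (damp r a) k + 2 / (1 - q) * level_gap a k"
      unfolding level_diff_damp level_diff2_damp q_def[symmetric] by simp
  qed
qed

text \<open>For every natural n, n <= n (n - 1) unless n = 1, so a small second factorial moment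
  forces the momentum onto the first mode. Entry n of \<open>lower\<close> belongs to mode n +
  1.\<close>

lemma momentum_damp_le_first:
  "momentum (damp r a) \<le> (cmod (a 1))\<^sup>2 + norm_sq (lower (lower (damp r a)))"
proof -
  have s1: "(\<lambda>n. (cmod (lower (damp r a) n))\<^sup>2) sums momentum (damp r a)"
    using finite_momentumD[OF damp_finite_momentum] unfolding norm_sq_def square_summable_def
    by (metis summable_sums)
  have s2: "(\<lambda>n. (if n = 0 then (cmod (a 1))\<^sup>2 else 0) + real n * (cmod (lower (damp r a) n))\<^sup>2) sums
      ((cmod (a 1))\<^sup>2 + norm_sq (lower (lower (damp r a))))"
    unfolding square_summable_lower(2)[OF summable_lower_damp]
    by (intro sums_add sums_single summable_sums summable_lower_damp)
  show ?thesis
  proof (rule sums_le[OF _ s1 s2])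
    fix n
    have "q * (cmod (a 1))\<^sup>2 \<le> (cmod (a 1))\<^sup>2"
      using q_bounds by (intro mult_left_le_one_le) auto
    then have "(cmod (lower (damp r a) 0))\<^sup>2 \<le> (cmod (a 1))\<^sup>2"
      by (simp add: lower_def cmod_damp q_def)
    moreover have "(cmod (lower (damp r a) n))\<^sup>2 \<le> real n * (cmod (lower (damp r a) n))\<^sup>2" if "n > 0"
      using that mult_right_mono[of 1 "real n" "(cmod (lower (damp r a) n))\<^sup>2"] by simp
    ultimately show "(cmod (lower (damp r a) n))\<^sup>2 \<le>
        (if n = 0 then (cmod (a 1))\<^sup>2 else 0) + real n * (cmod (lower (damp r a) n))\<^sup>2"
      by auto
  qed
qed

end

text \<open>If all of the relative angular momentum of \<open>a \<otimes> a\<close> is at most 2 and \<open>\<langle>a, lower a\<rangle> = 0\<close>,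
  comparing the first two moments of that angular momentum gives
  \<open>P\<^sup>2 + F/2 \<le> P\<close> with \<open>F = norm_sq (lower (lower a))\<close>, so \<open>P \<ge> 1\<close> forces \<open>F = 0\<close>. Damping the
  coefficients makes the second moment finite and lets the argument survive a small excess.\<close>

lemma first_coeff_near_one:
  assumes fm: "finite_momentum a" and one: "norm_sq a = 1"
    and P: "1 \<le> momentum a" and E: "excess a \<le> 1 / 10 ^ 12"
  shows "199 / 200 \<le> (cmod (a 1))\<^sup>2"
proof -
  \<comment> \<open>Balances two errors: the lost mass is at most (1 - q) P <= 3 / 10^6, while the
    gap, at most 1 / 10^12, is amplified by 2 / (1 - q) = 2 * 10^6.\<close>
  define q :: real where "q = 1 - 1 / 10 ^ 6"
  define r where "r = sqrt q"
  have q: "0 < q" "q < 1" by (auto simp: q_def)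
  have r: "0 < r" "r < 1" and rq: "r\<^sup>2 = q"
    using q by (auto simp: r_def)
  define b where "b = damp r a"
  define M where "M = norm_sq b"
  define P' where "P' = momentum b"
  define F where "F = norm_sq (lower (lower b))"
  define G where "G = suminf (level_gap a)"
  define D where "D = suminf (level_diff b)"
  define S where "S = suminf (level_diff2 b)"
  define Q where "Q = inner_seq (lower b) b"
  note fmb = damp_finite_momentum[OF fm r, folded b_def]
  note slow = summable_lower_damp[OF fm r, folded b_def]
  have ssb: "square_summable b" "square_summable (lower b)" "square_summable (lower (lower b))"
    using finite_momentumD[OF fmb] square_summable_lower[OF slow] by auto
  have G0: "0 \<le> G" unfolding G_def by (rule suminf_level_gap_nonneg[OF fm])
  have EQ: "excess a = (cmod (inner_seq (lower a) a))\<^sup>2 / 2 + G"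
    unfolding G_def by (rule excess_eq[OF fm one])
  have GE: "G \<le> excess a" unfolding EQ by simp
  have P3: "momentum a \<le> 3"
    using E contact_energy_nonneg[OF finite_momentumD(1)[OF fm]] unfolding excess_def by simp
  have M1: "M \<le> 1"
    using norm_sq_damp_le[OF fm r] by (simp add: M_def b_def one)
  have M2: "1 - 3 / 10 ^ 6 \<le> M"
  proof -
    have "1 - (1 - q) * momentum a \<le> M"
      using norm_sq_damp_ge[OF fm r] by (simp add: M_def b_def one rq)
    moreover have "(1 - q) * momentum a \<le> (1 - q) * 3"
      using P3 q by (intro mult_left_mono) auto
    ultimately show ?thesis by (simp add: q_def)
  qed
  have P'0: "0 \<le> P'" unfolding P'_def by (rule momentum_nonneg[OF fmb])
  have P'P: "P' \<le> momentum a" unfolding P'_def b_def by (rule momentum_damp_le[OF fm r])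
  have Deq: "D = M * P' - (cmod Q)\<^sup>2"
    using sums_unique[OF level_diff_sums[OF ssb(1,2)]] finite_momentumD(3)[OF fmb]
    by (simp add: D_def M_def P'_def Q_def)
  \<comment> \<open>By \<open>EQ\<close> the squared inner product for a plus 2 G is exactly twice
    the excess; the rest of the loss is 2 (1 - M^2) <= 12 / 10^6.\<close>
  have Dge: "momentum a - 12 / 10 ^ 6 - 2 * excess a \<le> D"
  proof -
    have "suminf (level_diff a) = momentum a - (cmod (inner_seq (lower a) a))\<^sup>2"
      using sums_unique[OF level_diff_sums[OF finite_momentumD(1,2)[OF fm]]] finite_momentumD(3)[OF fm]
      by (simp add: one)
    moreover have "suminf (level_diff a) - D \<le> 2 * (1 - M\<^sup>2) + 2 * G"
      using level_diff_damp_loss[OF fm r] by (simp add: D_def M_def G_def b_def one)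
    moreover have "1 - M\<^sup>2 \<le> 6 / 10 ^ 6"
    proof -
      have "(1 - 3 / 10 ^ 6)\<^sup>2 \<le> M\<^sup>2"
        using M2 by (intro power_mono) auto
      then show ?thesis by (simp add: power2_eq_square)
    qed
    ultimately show ?thesis using EQ by simp
  qed
  have MP: "M * P' \<le> P'"
    using M1 P'0 by (simp add: mult_left_le_one_le M_def norm_sq_nonneg ssb)
  have Q: "(cmod Q)\<^sup>2 \<le> 12 / 10 ^ 6 + 2 * excess a"
    using Deq Dge MP P'P by linarith
  have DP': "D \<le> P'" using Deq MP zero_le_power2[of "cmod Q"] by linarith
  have P'1: "1 - 12 / 10 ^ 6 - 2 * excess a \<le> P'"
    using Dge P DP' by linarith
  have SD: "S \<le> D + 2 * 10 ^ 6 * G"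
    using level_diff2_damp_le[OF fm r] by (simp add: S_def D_def G_def b_def rq q_def)
  have F0: "0 \<le> F" unfolding F_def by (intro norm_sq_nonneg ssb)
  \<comment> \<open>The cross term is at most |u|^2 / 24 + 24 |Q|^2 with |u|^2 <= 3 F, so it costs
    only F / 8 of the main term M F / 2.\<close>
  have Sge: "M * F / 2 + P'\<^sup>2 - F / 8 - 24 * (cmod Q)\<^sup>2 \<le> S"
  proof -
    define u where "u = inner_seq (lower (lower b)) (lower b)"
    have S: "S = (M * F + (cmod (inner_seq (lower (lower b)) b))\<^sup>2) / 2 + P'\<^sup>2
        - 2 * Re (u * inner_seq b (lower b))"
      using sums_unique[OF level_diff2_sums[OF ssb]] finite_momentumD(3)[OF fmb]
      by (simp add: S_def M_def P'_def F_def u_def)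
    have "(cmod u)\<^sup>2 \<le> F * P'"
      using inner_seq_Cauchy_Schwarz[OF ssb(3,2)] finite_momentumD(3)[OF fmb]
      by (simp add: u_def F_def P'_def)
    also have "\<dots> \<le> F * 3"
      using F0 P'P P3 by (intro mult_left_mono) auto
    finally have u: "(cmod u)\<^sup>2 \<le> 3 * F" by simp
    have "Re (u * inner_seq b (lower b)) \<le> cmod (u * inner_seq b (lower b))"
      by (rule complex_Re_le_cmod)
    also have "\<dots> = cmod u * cmod Q"
      using inner_seq_cnj[OF ssb(2,1)] by (simp add: norm_mult Q_def)
    finally have "2 * Re (u * inner_seq b (lower b)) \<le> 2 * (cmod u * cmod Q)" by simp
    also have "\<dots> \<le> (cmod u)\<^sup>2 / 24 + 24 * (cmod Q)\<^sup>2"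
      using zero_le_power2[of "cmod u - 24 * cmod Q"] by (simp add: power2_eq_square algebra_simps)
    finally show ?thesis
      using u zero_le_power2[of "cmod (inner_seq (lower (lower b)) b)"]
      unfolding S add_divide_distrib by linarith
  qed
  have "F * (1 / 4) \<le> F * (M / 2 - 1 / 8)"
    using F0 M2 by (intro mult_left_mono) auto
  \<comment> \<open>The right side is at most a small error by \<open>P'1\<close>; this is how P >=
    1 forces F to be small.\<close>
  moreover have "P' - P'\<^sup>2 \<le> 1 - P'"
    using zero_le_power2[of "P' - 1"] by (simp add: power2_eq_square algebra_simps)
  moreover have "F * (M / 2 - 1 / 8) = M * F / 2 - F / 8"
    by (simp add: algebra_simps)
  ultimately have "F / 4 \<le> 1 - P' + 24 * (cmod Q)\<^sup>2 + 2 * 10 ^ 6 * G"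
    using Sge SD DP' by linarith
  moreover have "P' \<le> (cmod (a 1))\<^sup>2 + F"
    using momentum_damp_le_first[OF fm r] by (simp add: P'_def F_def b_def)
  ultimately show ?thesis
    using P'1 Q E GE G0 by simp
qed

section \<open>Coercivity near the first mode\<close>

text \<open>Subtracting its pairs from those of a leaves exactly the pairs that contain mode 1,
  which carry the quadratic part of the gap near the first mode.\<close>

definition drop_first :: "(nat \<Rightarrow> complex) \<Rightarrow> nat \<Rightarrow> complex" where
  "drop_first a = a(1 := 0)"

lemma drop_first_sums:
  assumes "finite_momentum a"
  shows "finite_momentum (drop_first a)"
    "norm_sq (drop_first a) = norm_sq a - (cmod (a 1))\<^sup>2"
    "momentum (drop_first a) = momentum a - (cmod (a 1))\<^sup>2"
proof -
  have e: "(cmod (drop_first a n))\<^sup>2 = (cmod (a n))\<^sup>2 - (if n = 1 then (cmod (a 1))\<^sup>2 else 0)" for n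
    by (simp add: drop_first_def)
  have e': "real n * (cmod (drop_first a n))\<^sup>2 =
      real n * (cmod (a n))\<^sup>2 - (if n = 1 then (cmod (a 1))\<^sup>2 else 0)" for n
    by (simp add: drop_first_def)
  have 1: "(\<lambda>n. (cmod (drop_first a n))\<^sup>2) sums (norm_sq a - (cmod (a 1))\<^sup>2)"
    unfolding e norm_sq_def using assms
    by (intro sums_diff sums_single summable_sums) (auto simp: finite_momentum_def square_summable_def)
  have 2: "(\<lambda>n. real n * (cmod (drop_first a n))\<^sup>2) sums (momentum a - (cmod (a 1))\<^sup>2)"
    unfolding e' momentum_def using assms
    by (intro sums_diff sums_single summable_sums) (auto simp: finite_momentum_def)
  show "finite_momentum (drop_first a)"
    using 1 2 by (auto simp: finite_momentum_def square_summable_def dest: sums_summable)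
  show "norm_sq (drop_first a) = norm_sq a - (cmod (a 1))\<^sup>2"
    unfolding norm_sq_def[of "drop_first a"] using 1 by (rule sums_unique[symmetric])
  show "momentum (drop_first a) = momentum a - (cmod (a 1))\<^sup>2"
    unfolding momentum_def[of "drop_first a"] using 2 by (rule sums_unique[symmetric])
qed

lemma suminf_tail_le:
  fixes f :: "nat \<Rightarrow> real"
  assumes "summable f" "\<And>n. 0 \<le> f n"
  shows "(\<Sum>n. f (n + m)) \<le> suminf f"
  using suminf_split_initial_segment[OF assms(1), of m] sum_nonneg[of "{..<m}" f] assms(2) by simp

text \<open>The pair \<open>e\<^sub>1 \<otimes> e\<^sub>n + e\<^sub>n \<otimes> e\<^sub>1\<close> with \<open>n \<ge> 3\<close> has relative angular momentum 4 or more with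
  positive weight.\<close>

lemma gap_form_two_point:
  assumes n: "3 \<le> n"
  shows "real n / 8 * (cmod (a 1 * a n))\<^sup>2 \<le> level_weight (Suc n) *
    gap_form (Suc n) (\<lambda>j. pair_level a (Suc n) j - pair_level (drop_first a) (Suc n) j)"
proof -
  define c where "c = taylor a 1 * taylor a n"
  define x where "x j = (if j = 1 then c else 0) + (if j = n then c else 0)" for j
  have x: "pair_level a (Suc n) j - pair_level (drop_first a) (Suc n) j = x j" if "j \<le> Suc n" for j
    using n that by (auto simp: pair_level_def x_def c_def taylor_def drop_first_def le_Suc_eq)
  have x2: "(cmod (x j))\<^sup>2 = (cmod c)\<^sup>2 * ((if j = 1 then 1 else 0) + (if j = n then 1 else 0))" for j
    using n by (auto simp: x_def)
  \<comment> \<open>For n >= 3 the positions 1 and n are not adjacent, so the four jumps at 0, 1, n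
    - 1 and n do not interact.\<close>
  have d2: "(cmod (x (Suc j) - x j))\<^sup>2 = (cmod c)\<^sup>2 * ((if j = 0 then 1 else 0) + (if j = 1 then 1 else 0)
      + (if j = n - 1 then 1 else 0) + (if j = n then 1 else 0))" for j
    using n by (auto simp: x_def)
  have cf: "(cmod c)\<^sup>2 = fact n * (cmod (a 1 * a n))\<^sup>2"
    by (simp add: c_def taylor_def norm_mult power_mult_distrib)
  have avg_x: "avg_sq (Suc n) x = (cmod c)\<^sup>2 * (2 * (real n + 1)) / 2 ^ Suc n"
    unfolding x2 binomial_avg_cmult using n
    by (simp add: binomial_avg_eq_sum algebra_simps sum.distrib if_distrib[of "\<lambda>x. _ * x"] sum.delta
        del: binomial_avg.simps sum.atMost_Suc cong: if_cong)
  have avg_d: "avg_sq n (diff_seq x) = (cmod c)\<^sup>2 * (2 * (real n + 1)) / 2 ^ n"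
  proof -
    have "n choose (n - 1) = n"
      using n binomial_symmetric[of 1 n] by simp
    then show ?thesis
      unfolding d2 binomial_avg_cmult using n
      by (simp add: binomial_avg_eq_sum algebra_simps sum.distrib if_distrib[of "\<lambda>x. _ * x"] sum.delta
          cong: if_cong)
  qed
  have "gap_form (Suc n) (\<lambda>j. pair_level a (Suc n) j - pair_level (drop_first a) (Suc n) j) =
      gap_form (Suc n) x"
  proof -
    have "binomial_avg (Suc n) (\<lambda>j. pair_level a (Suc n) j - pair_level (drop_first a) (Suc n) j) =
        binomial_avg (Suc n) x"
      "avg_sq (Suc n) (\<lambda>j. pair_level a (Suc n) j - pair_level (drop_first a) (Suc n) j) =
        avg_sq (Suc n) x"
      "avg_sq n (diff_seq (\<lambda>j. pair_level a (Suc n) j - pair_level (drop_first a) (Suc n) j)) =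
        avg_sq n (diff_seq x)"
      by (intro binomial_avg_cong; simp add: x del: pair_level_def)+
    then show ?thesis
      unfolding gap_form_def binomial_var_def by simp
  qed
  moreover have "real n / 8 * (cmod (a 1 * a n))\<^sup>2 \<le> level_weight (Suc n) * gap_form (Suc n) x"
  proof -
    define A where "A = (cmod (a 1 * a n))\<^sup>2"
    have g: "level_weight (Suc n) * gap_form (Suc n) x =
       (real n + 1) / 2 * A - 2 * A + level_weight (Suc n) * (cmod (binomial_avg (Suc n) x))\<^sup>2"
    proof -
      have "level_weight (Suc n) * (N / 8 * (fact n * A * (2 * N) / 2 ^ n)
          - (fact n * A * (2 * N) / 2 ^ Suc n - B)) =
          N / 2 * A - 2 * A + level_weight (Suc n) * B" if "N = real (Suc n)" for N B
        unfolding level_weight_def fact_Suc of_nat_mult using that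
        by (simp add: divide_simps del: of_nat_Suc) (simp add: algebra_simps)
      from this[of "real (Suc n)"] show ?thesis
        unfolding gap_form_def binomial_var_def avg_x diff_Suc_1 avg_d cf A_def[symmetric]
        by (simp only: of_nat_Suc add.commute)
    qed
    have A0: "0 \<le> A" by (simp add: A_def)
    \<comment> \<open>At n = 3 the coefficient (n + 1) / 2 - 2 vanishes and the contact term alone
      gives the bound; from n = 4 on the coefficient is at least n / 8.\<close>
    show ?thesis
    proof (cases "n = 3")
      case True
      have "binomial_avg (Suc n) x = c / 2"
        unfolding True by (simp add: binomial_avg_eq_sum x_def True numeral_eq_Suc)
      moreover have "level_weight (Suc n) = 2 / 3"
        by (simp add: True level_weight_def fact_numeral)
      moreover have "(cmod c)\<^sup>2 = 6 * A"
        using cf by (simp add: True A_def fact_numeral)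
      ultimately have "level_weight (Suc n) * (cmod (binomial_avg (Suc n) x))\<^sup>2 = A"
        by (simp only: norm_divide power_divide) simp
      then show ?thesis
        unfolding g A_def[symmetric] using A0 True by simp
    next
      case False
      have "real n / 8 * A \<le> ((real n + 1) / 2 - 2) * A"
      proof -
        have "4 \<le> real n" using n False by simp
        then show ?thesis using A0 by (intro mult_right_mono) argo+
      qed
      moreover have "0 \<le> level_weight (Suc n) * (cmod (binomial_avg (Suc n) x))\<^sup>2"
        using level_weight_pos[of "Suc n"] by simp
      ultimately show ?thesis
        unfolding g A_def[symmetric] left_diff_distrib by linarith
    qed
  qed
  ultimately show ?thesis by simp
qed

text \<open>\<open>gap_form_diff_le\<close> extracts the pairs of mode 1 with mode n from the gap of
  a. The error is twice the gap of \<open>drop_first a\<close>, at most its norm times its momentum,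
  and thus carries the small factor m.\<close>

lemma high_modes_bound:
  assumes fm: "finite_momentum a"
  defines "m \<equiv> norm_sq a - (cmod (a 1))\<^sup>2" and "T \<equiv> (\<Sum>n. real (n + 3) * (cmod (a (n + 3)))\<^sup>2)"
  shows "(cmod (a 1))\<^sup>2 / 8 * T \<le> 2 * suminf (level_gap a) + m * (2 * (cmod (a 2))\<^sup>2 + T)"
proof -
  let ?h = "drop_first a"
  note fmh = drop_first_sums(1)[OF fm]
  have sum_T: "(\<lambda>n. real (n + 3) * (cmod (a (n + 3)))\<^sup>2) sums T"
    unfolding T_def
    using fm summable_ignore_initial_segment[of "\<lambda>n. real n * (cmod (a n))\<^sup>2" 3]
    by (intro summable_sums) (simp add: finite_momentum_def)
  have P: "momentum a = (cmod (a 1))\<^sup>2 + 2 * (cmod (a 2))\<^sup>2 + T"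
    using fm suminf_split_initial_segment[of "\<lambda>n. real n * (cmod (a n))\<^sup>2" 3]
    unfolding finite_momentum_def momentum_def T_def by (simp add: numeral_3_eq_3 numeral_2_eq_2)
  have sg: "summable (level_gap a)" "summable (level_gap ?h)"
    by (intro sums_summable[OF level_gap_sums] fm fmh)+
  have s2: "(\<lambda>n. 2 * level_gap a (n + 4) + 2 * level_gap ?h (n + 4)) sums
      (2 * (\<Sum>n. level_gap a (n + 4)) + 2 * (\<Sum>n. level_gap ?h (n + 4)))"
    by (intro sums_add sums_mult summable_sums summable_ignore_initial_segment sg)
  have s1: "(\<lambda>n. (cmod (a 1))\<^sup>2 / 8 * (real (n + 3) * (cmod (a (n + 3)))\<^sup>2)) sums ((cmod (a 1))\<^sup>2 / 8 * T)"
    by (intro sums_mult sum_T)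
  have "(cmod (a 1))\<^sup>2 / 8 * T \<le> 2 * (\<Sum>n. level_gap a (n + 4)) + 2 * (\<Sum>n. level_gap ?h (n + 4))"
  proof (rule sums_le[OF _ s1 s2])
    fix n :: nat
    let ?k = "Suc (n + 3)"
    have "real (n + 3) / 8 * (cmod (a 1 * a (n + 3)))\<^sup>2 \<le> level_weight ?k *
        gap_form ?k (\<lambda>j. pair_level a ?k j - pair_level ?h ?k j)"
      by (rule gap_form_two_point) simp
    also have "\<dots> \<le> level_weight ?k *
        (2 * gap_form ?k (pair_level a ?k) + 2 * gap_form ?k (pair_level ?h ?k))"
      by (intro mult_left_mono gap_form_diff_le less_imp_le[OF level_weight_pos]; rule pair_level_symmetric)
    also have "\<dots> = 2 * level_gap a (n + 4) + 2 * level_gap ?h (n + 4)"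
      by (simp add: level_gap_def algebra_simps numeral_eq_Suc)
    finally show "(cmod (a 1))\<^sup>2 / 8 * (real (n + 3) * (cmod (a (n + 3)))\<^sup>2) \<le>
        2 * level_gap a (n + 4) + 2 * level_gap ?h (n + 4)"
      by (simp add: norm_mult power_mult_distrib mult_ac)
  qed
  also have "\<dots> \<le> 2 * suminf (level_gap a) + 2 * suminf (level_gap ?h)"
    by (intro add_mono mult_left_mono suminf_tail_le sg level_gap_nonneg) auto
  also have "2 * suminf (level_gap ?h) \<le> m * (2 * (cmod (a 2))\<^sup>2 + T)"
  proof -
    have "suminf (level_gap ?h) \<le> suminf (\<lambda>k. level_diff ?h k / 2)"
      by (intro suminf_le level_gap_le sg summable_divide sums_summable[OF level_diff_sums]
          finite_momentumD fmh)
    also have "\<dots> = (norm_sq ?h * momentum ?h - (cmod (inner_seq (lower ?h) ?h))\<^sup>2) / 2"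
      by (intro sums_unique[symmetric] sums_divide)
         (use level_diff_sums[OF finite_momentumD(1,2)[OF fmh]] finite_momentumD(3)[OF fmh] in simp)
    finally have "2 * suminf (level_gap ?h) \<le> norm_sq ?h * momentum ?h"
      using zero_le_power2[of "cmod (inner_seq (lower ?h) ?h)"] by argo
    then show ?thesis
      by (simp add: drop_first_sums[OF fm] m_def P)
  qed
  finally show ?thesis by simp
qed

text \<open>To second order E sees modes n >= 3 through the gap and modes 0 and 2 only through Q. If
  Q and the high modes vanish, then 2 Z = X up to higher order and P - 1 is about Z - X = - X / 2.
  This room pays for the term with 1 / 20, which is what uniqueness rests on.\<close>

lemma local_coercivity:
  assumes fm: "finite_momentum a" and one: "norm_sq a = 1"
    and near: "199 / 200 \<le> (cmod (a 1))\<^sup>2"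
  shows "momentum a - 1 + (1 - (cmod (a 1))\<^sup>2) / 20 \<le> 30 * excess a"
proof -
  define T where "T = (\<Sum>n. real (n + 3) * (cmod (a (n + 3)))\<^sup>2)"
  define R where "R = (\<Sum>n. lower a (n + 2) * cnj (a (n + 2)))"
  define m where "m = 1 - (cmod (a 1))\<^sup>2"
  define X where "X = (cmod (a 0))\<^sup>2"
  define Y where "Y = (cmod (a 1))\<^sup>2"
  define Z where "Z = (cmod (a 2))\<^sup>2"
  define V where "V = (\<Sum>n. (cmod (a (n + 2)))\<^sup>2)"
  define Q where "Q = inner_seq (lower a) a"
  define G where "G = suminf (level_gap a)"
  have sq: "summable (\<lambda>n. (cmod (a n))\<^sup>2)" "summable (\<lambda>n. real n * (cmod (a n))\<^sup>2)"
    using fm by (auto simp: finite_momentum_def square_summable_def)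
  have P: "momentum a = Y + 2 * Z + T"
    using suminf_split_initial_segment[OF sq(2), of 3]
    unfolding momentum_def T_def Y_def Z_def by (simp add: numeral_3_eq_3 numeral_2_eq_2)
  have XYV: "X + Y + V = 1"
    using suminf_split_initial_segment[OF sq(1), of 2] one
    unfolding norm_sq_def V_def X_def Y_def by (simp add: numeral_2_eq_2)
  have tail3: "summable (\<lambda>n. (cmod (a (n + 3)))\<^sup>2)" "summable (\<lambda>n. real (n + 3) * (cmod (a (n + 3)))\<^sup>2)"
    using summable_ignore_initial_segment[OF sq(1), of 3] summable_ignore_initial_segment[OF sq(2), of 3]
    by auto
  have T0: "0 \<le> T"
    unfolding T_def by (rule suminf_nonneg[OF tail3(2)]) simp
  have V: "Z \<le> V" "V \<le> Z + T"
  proof -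
    have "V = Z + (\<Sum>n. (cmod (a (n + 3)))\<^sup>2)"
      using suminf_split_head[OF summable_ignore_initial_segment[OF sq(1), of 2]]
      unfolding V_def Z_def by (simp add: numeral_3_eq_3 numeral_2_eq_2)
    moreover have "(\<Sum>n. (cmod (a (n + 3)))\<^sup>2) \<le> T"
      unfolding T_def
    proof (rule suminf_le[OF _ tail3])
      show "(cmod (a (n + 3)))\<^sup>2 \<le> real (n + 3) * (cmod (a (n + 3)))\<^sup>2" for n
        using mult_right_mono[of 1 "real (n + 3)" "(cmod (a (n + 3)))\<^sup>2"] by simp
    qed
    moreover have "0 \<le> (\<Sum>n. (cmod (a (n + 3)))\<^sup>2)"
      by (rule suminf_nonneg[OF tail3(1)]) simp
    ultimately show "Z \<le> V" "V \<le> Z + T" by auto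
  qed
  have E: "excess a = (cmod Q)\<^sup>2 / 2 + G"
    unfolding Q_def G_def by (rule excess_eq[OF fm one])
  have G0: "0 \<le> G" unfolding G_def by (rule suminf_level_gap_nonneg[OF fm])
  have high: "Y / 8 * T \<le> 2 * G + m * (2 * Z + T)"
    using high_modes_bound[OF fm] by (simp add: one Y_def Z_def T_def m_def G_def)
  \<comment> \<open>R pairs only modes n and n + 1 with n >= 2, so it is of second order in the
    distance from the first mode.\<close>
  have Q: "Q = a 1 * cnj (a 0) + complex_of_real (sqrt 2) * a 2 * cnj (a 1) + R"
    using suminf_split_initial_segment[OF summable_norm_cancel[OF summable_norm_mult[OF
            finite_momentumD(2,1)[OF fm]]], of 2]
    unfolding Q_def R_def inner_seq_def by (simp add: numeral_2_eq_2 lower_def)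
  have R: "(cmod R)\<^sup>2 \<le> T * V"
  proof -
    have ss: "square_summable (\<lambda>n. lower a (n + 2))" "square_summable (\<lambda>n. a (n + 2))"
      using summable_ignore_initial_segment[OF finite_momentumD(2)[OF fm, unfolded square_summable_def], of 2]
        summable_ignore_initial_segment[OF sq(1), of 2]
      by (simp_all only: square_summable_def)
    have "norm_sq (\<lambda>n. lower a (n + 2)) = T"
      unfolding norm_sq_def T_def
      by (simp add: lower_def norm_mult power_mult_distrib numeral_3_eq_3 del: of_nat_Suc)
    then show ?thesis
      using inner_seq_Cauchy_Schwarz[OF ss] by (simp add: R_def V_def inner_seq_def norm_sq_def)
  qed
  have Y: "199 / 200 \<le> Y" "m = 1 - Y" "0 \<le> X" "0 \<le> Z"
    using near by (auto simp: Y_def m_def X_def Z_def)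
  have V1: "V \<le> 1 / 200" using XYV Y by linarith
  have TV: "T * V \<le> T / 200"
    using mult_left_mono[OF V1 T0] by simp
  \<comment> \<open>The factor 3 / 2 lies strictly between 1 and 2: above 1 to absorb the cross
    terms, below 2 so that Z - X keeps a negative multiple of X.\<close>
  have ZY: "2 * Z * Y \<le> 3 / 2 * X * Y + 6 * (cmod Q)\<^sup>2 + 6 * (cmod R)\<^sup>2"
  proof -
    let ?u = "cmod (a 1) * cmod (a 0)"
    have "complex_of_real (sqrt 2) * a 2 * cnj (a 1) = Q - R - a 1 * cnj (a 0)"
      using Q by simp
    then have "sqrt 2 * cmod (a 2) * cmod (a 1) = cmod (Q - R - a 1 * cnj (a 0))"
      by (metis abs_of_nonneg complex_mod_cnj norm_mult norm_of_real real_sqrt_ge_zero zero_le_numeral)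
    also have "\<dots> \<le> cmod Q + cmod R + ?u"
      using norm_triangle_ineq4[of "Q - R" "a 1 * cnj (a 0)"] norm_triangle_ineq4[of Q R]
      by (simp add: norm_mult)
    finally have "(sqrt 2 * cmod (a 2) * cmod (a 1))\<^sup>2 \<le> (cmod Q + cmod R + ?u)\<^sup>2"
      by (intro power_mono) auto
    also have "\<dots> \<le> 3 / 2 * ?u\<^sup>2 + 6 * (cmod Q)\<^sup>2 + 6 * (cmod R)\<^sup>2"
    proof -
      have "(q + s + u)\<^sup>2 \<le> 3 / 2 * u\<^sup>2 + 6 * q\<^sup>2 + 6 * s\<^sup>2" for q s u :: real
        using zero_le_power2[of "u / 2 - 2 * q"] zero_le_power2[of "u / 2 - 2 * s"] zero_le_power2[of "q - s"]
        by (simp add: power2_eq_square algebra_simps)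
      then show ?thesis .
    qed
    finally show ?thesis
      by (simp add: power_mult_distrib X_def Y_def Z_def mult_ac)
  qed
  have Z: "199 / 200 * (2 * Z - 3 / 2 * X) \<le> 6 * (cmod Q)\<^sup>2 + 6 * (T / 200)"
  proof (cases "0 \<le> 2 * Z - 3 / 2 * X")
    case True
    have "199 / 200 * (2 * Z - 3 / 2 * X) \<le> Y * (2 * Z - 3 / 2 * X)"
      using True Y by (intro mult_right_mono) auto
    also have "\<dots> = 2 * Z * Y - 3 / 2 * X * Y" by (simp add: algebra_simps)
    also have "\<dots> \<le> 6 * (cmod Q)\<^sup>2 + 6 * (T / 200)"
      using ZY R TV by linarith
    finally show ?thesis .
  next
    case False
    then show ?thesis using T0 zero_le_power2[of "cmod Q"] by argo
  qed
  have "199 / 200 / 8 * T \<le> Y / 8 * T"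
    using Y T0 by (intro mult_right_mono) auto
  moreover have "m * (2 * Z + T) \<le> 1 / 200 * (2 * Z + T)"
    using Y T0 by (intro mult_right_mono) auto
  ultimately have T: "199 / 1600 * T \<le> 2 * G + (2 * Z + T) / 200"
    using high by argo
  have "momentum a - 1 + (1 - (cmod (a 1))\<^sup>2) / 20 = Z + T + (Z - V) - X + (X + V) / 20"
    using P XYV Y unfolding Y_def[symmetric] by argo
  also have "\<dots> \<le> 30 * excess a"
    using V T Z G0 Y T0 zero_le_power2[of "cmod Q"] unfolding E by argo
  finally show ?thesis .
qed

text \<open>Three regimes: for P < 1 both terms have the right sign; for E <= 1 / 10^12 and P >= 1
  local coercivity yields P - 1 <= 30 E; for larger E, nonnegativity of the contact energy yields P
  - 1 <= 1 + 2 E, and a bound on \<epsilon> ten times below the threshold beats this.\<close>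

theorem energy_gap:
  assumes fm: "finite_momentum a" and one: "norm_sq a = 1"
    and \<epsilon>: "0 < \<epsilon>" "\<epsilon> < 1 / 10 ^ 13"
  shows "0 \<le> excess a - \<epsilon> * (momentum a - 1)"
    and "excess a - \<epsilon> * (momentum a - 1) = 0 \<Longrightarrow> cmod (a 1) = 1"
proof -
  have E0: "0 \<le> excess a" by (rule excess_nonneg[OF fm one])
  have a1: "(cmod (a 1))\<^sup>2 \<le> 1"
  proof -
    have "(\<Sum>n\<in>{1}. (cmod (a n))\<^sup>2) \<le> norm_sq a"
      unfolding norm_sq_def using fm
      by (intro sum_le_suminf) (auto simp: finite_momentum_def square_summable_def)
    then show ?thesis by (simp add: one)
  qed
  have "0 \<le> excess a - \<epsilon> * (momentum a - 1) \<and>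
      (excess a - \<epsilon> * (momentum a - 1) = 0 \<longrightarrow> (cmod (a 1))\<^sup>2 = 1)"
  proof (cases "momentum a < 1")
    case True
    then have "\<epsilon> * (momentum a - 1) < 0" using \<epsilon> by (simp add: mult_pos_neg)
    then show ?thesis using E0 by simp
  next
    case P: False
    show ?thesis
    proof (cases "excess a \<le> 1 / 10 ^ 12")
      case True
      have "199 / 200 \<le> (cmod (a 1))\<^sup>2"
        using first_coeff_near_one[OF fm one _ True] P by simp
      then have loc: "momentum a - 1 + (1 - (cmod (a 1))\<^sup>2) / 20 \<le> 30 * excess a"
        by (rule local_coercivity[OF fm one])
      have "\<epsilon> * (momentum a - 1) \<le> 1 / 30 * (momentum a - 1)"
        using \<epsilon> P by (intro mult_right_mono) auto
      then have "30 * (\<epsilon> * (momentum a - 1)) + (1 - (cmod (a 1))\<^sup>2) / 20 \<le> 30 * excess a"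
        using loc by simp
      moreover define w y where "w = \<epsilon> * (momentum a - 1)" and "y = (cmod (a 1))\<^sup>2"
      ultimately have "30 * w + (1 - y) / 20 \<le> 30 * excess a" "y \<le> 1"
        using a1 by auto
      then show ?thesis
        unfolding w_def[symmetric] y_def[symmetric] by (intro conjI impI) argo+
    next
      case False
      have "momentum a - 1 \<le> 1 + 2 * excess a"
        using contact_energy_nonneg[OF finite_momentumD(1)[OF fm]] unfolding excess_def by simp
      then have "\<epsilon> * (momentum a - 1) \<le> \<epsilon> * (1 + 2 * excess a)"
        using \<epsilon> by (intro mult_left_mono) auto
      also have "\<dots> \<le> 1 / 10 ^ 13 * (1 + 2 * excess a)"
        using \<epsilon> E0 by (intro mult_right_mono) auto
      also have "\<dots> < excess a" using False by simp
      finally show ?thesis by simp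
    qed
  qed
  moreover have "cmod (a 1) \<noteq> - 1"
    using norm_ge_zero[of "a 1"] by linarith
  ultimately show "0 \<le> excess a - \<epsilon> * (momentum a - 1)"
    and "excess a - \<epsilon> * (momentum a - 1) = 0 \<Longrightarrow> cmod (a 1) = 1"
    by (auto simp: power2_eq_1_iff)
qed

section \<open>Gaussian integrals of entire functions\<close>

text \<open>Up to a null set, an open set is a countable disjoint union of balls (Vitali), and balls are
  visibly rotation invariant.\<close>

lemma emeasure_rotate_open_ge:
  fixes U :: "complex set"
  assumes U: "open U" and w: "cmod w = 1"
  shows "emeasure lborel U \<le> emeasure lborel ((*) w ` U)"
proof -
  have im: "(*) w ` ball x s = ball (w * x) s" for x s
  proof -
    have d: "dist (w * x) (w * y) = dist x y" for y
      using w norm_mult[of w "x - y"] by (simp add: dist_norm right_diff_distrib)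
    show ?thesis
    proof (intro equalityI subsetI)
      fix y assume "y \<in> (*) w ` ball x s"
      then obtain y' where "y' \<in> ball x s" "y = w * y'" by blast
      then show "y \<in> ball (w * x) s" by (simp only: mem_ball d)
    next
      fix y assume y: "y \<in> ball (w * x) s"
      have eq: "w * (y / w) = y" using w by auto
      have "y / w \<in> ball x s" using y d[of "y / w"] unfolding eq by (simp only: mem_ball)
      with eq[symmetric] show "y \<in> (*) w ` ball x s" by (rule image_eqI)
    qed
  qed
  define K where "K = {p :: complex \<times> real. 0 < snd p \<and> ball (fst p) (snd p) \<subseteq> U}"
  have cov: "\<exists>i. i \<in> K \<and> x \<in> ball (fst i) (snd i) \<and> snd i < d" if "x \<in> U" "0 < d" for x d
  proof -
    obtain e where e: "e > 0" "ball x e \<subseteq> U" by (rule openE[OF U \<open>x \<in> U\<close>])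
    have "(x, min e (d / 2)) \<in> K" using e that by (auto simp: K_def)
    then show ?thesis using e that by (intro exI[of _ "(x, min e (d / 2))"]) auto
  qed
  obtain C where C: "countable C" "C \<subseteq> K"
    "pairwise (\<lambda>i j. disjnt (ball (fst i) (snd i)) (ball (fst j) (snd j))) C"
    "negligible (U - (\<Union>i\<in>C. ball (fst i) (snd i)))"
    by (rule Vitali_covering_theorem_balls[of U K fst snd, OF cov])
  define V where "V = (\<Union>i\<in>C. ball (fst i) (snd i))"
  have "open V" unfolding V_def by (intro open_UN ballI open_ball)
  then have V: "V \<in> sets lborel" "U \<in> sets lborel"
    using U by auto
  then have N: "U - V \<in> sets lborel" by auto
  \<comment> \<open>The covering theorem speaks of the completed measure; as the difference is a
    Borel set, it is null for \<open>lborel\<close> too.\<close>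
  have "U - V \<in> null_sets lborel"
    using C(4) N unfolding negligible_iff_null_sets V_def[symmetric]
    by (subst (asm) null_sets_completion_iff) auto
  then have "emeasure lborel (V \<union> (U - V)) = emeasure lborel V"
    using V by (intro emeasure_Un_null_set) auto
  moreover have "V \<subseteq> U" using C(2) by (auto simp: V_def K_def)
  ultimately have "emeasure lborel U = emeasure lborel V"
    by (simp add: Un_absorb1)
  also have "\<dots> = (\<integral>\<^sup>+i. emeasure lborel (ball (fst i) (snd i)) \<partial>count_space C)"
    unfolding V_def using C(1,3)
    by (intro emeasure_UN_countable) (auto simp: disjoint_family_on_def pairwise_def disjnt_def)
  also have "\<dots> = (\<integral>\<^sup>+i. emeasure lborel (ball (w * fst i) (snd i)) \<partial>count_space C)"
  proof (rule nn_integral_cong)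
    fix i assume "i \<in> space (count_space C)"
    then have "0 \<le> snd i" using C(2) by (auto simp: K_def)
    then show "emeasure lborel (ball (fst i) (snd i)) = emeasure lborel (ball (w * fst i) (snd i))"
      by (simp add: emeasure_ball)
  qed
  also have "\<dots> = emeasure lborel (\<Union>i\<in>C. ball (w * fst i) (snd i))"
  proof (rule emeasure_UN_countable[symmetric])
    have "inj ((*) w)" using w by (intro injI) auto
    then show "disjoint_family_on (\<lambda>i. ball (w * fst i) (snd i)) C"
      using C(3) unfolding disjoint_family_on_def pairwise_def disjnt_def im[symmetric]
      by (metis image_Int image_empty)
  qed (use C(1) in auto)
  also have "(\<Union>i\<in>C. ball (w * fst i) (snd i)) \<subseteq> (*) w ` U"
    unfolding im[symmetric] using C(2) by (force simp: K_def)
  then have "emeasure lborel (\<Union>i\<in>C. ball (w * fst i) (snd i)) \<le> emeasure lborel ((*) w ` U)"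
    using w U by (intro emeasure_mono) (auto intro!: borel_open open_times_image)
  finally show ?thesis .
qed

text \<open>The inequality for open sets, applied to w and to its inverse, gives equality on boxes,
  and these determine the measure.\<close>

lemma lborel_rotate:
  assumes w: "cmod w = 1"
  shows "distr lborel borel ((*) w) = (lborel :: complex measure)"
proof (rule lborel_eqI[symmetric])
  fix l u :: complex
  have w0: "w \<noteq> 0" using w by auto
  have pre: "(*) w -` S = (*) (inverse w) ` S" for S
    using w0 by (auto simp: image_iff field_simps intro!: bexI)
  have open': "open ((*) (inverse w) ` box l u)"
    using w0 by (intro open_times_image) auto
  have "emeasure (distr lborel borel ((*) w)) (box l u) = emeasure lborel ((*) (inverse w) ` box l u)"
    by (simp add: emeasure_distr pre)
  also have "\<dots> = emeasure lborel (box l u)"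
  proof (rule antisym)
    have "emeasure lborel ((*) (inverse w) ` box l u) \<le>
        emeasure lborel ((*) w ` ((*) (inverse w) ` box l u))"
      by (rule emeasure_rotate_open_ge[OF open' w])
    also have "(*) w ` ((*) (inverse w) ` box l u) = box l u"
      proof -
      have *: "w * (inverse w * x) = x" for x using w0 by (simp add: divide_simps)
      show ?thesis unfolding image_image * by simp
    qed
    finally show "emeasure lborel ((*) (inverse w) ` box l u) \<le> emeasure lborel (box l u)" .
    show "emeasure lborel (box l u) \<le> emeasure lborel ((*) (inverse w) ` box l u)"
      using w by (intro emeasure_rotate_open_ge) (auto simp: norm_inverse)
  qed
  finally show "emeasure (distr lborel borel ((*) w)) (box l u) = (\<Prod>b\<in>Basis. (u - l) \<bullet> b)"
    if "\<And>b. b \<in> Basis \<Longrightarrow> l \<bullet> b \<le> u \<bullet> b"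
    using that by (simp add: emeasure_lborel_box)
qed simp

section \<open>Parseval's identity for radial weights of bounded support\<close>

context
  fixes v :: "complex \<Rightarrow> real" and R :: real
  assumes v_meas [measurable]: "v \<in> borel_measurable borel"
    and v_bounds: "\<And>z. 0 \<le> v z" "\<And>z. v z \<le> 1"
    and v_support: "\<And>z. R < cmod z \<Longrightarrow> v z = 0"
    and v_rotate: "\<And>w z. cmod w = 1 \<Longrightarrow> v (w * z) = v z"
begin

lemma integrable_weight:
  fixes f :: "complex \<Rightarrow> 'a::{banach, second_countable_topology}"
  assumes f: "continuous_on UNIV f"
  shows "integrable lborel (\<lambda>z. v z *\<^sub>R f z)"
proof -
  have [measurable]: "f \<in> borel_measurable borel"
    using f by (rule borel_measurable_continuous_onI)
  have "compact (f ` cball 0 R)"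
    using f by (intro compact_continuous_image) (auto intro: continuous_on_subset)
  then obtain B where B: "\<And>z. z \<in> cball 0 R \<Longrightarrow> norm (f z) \<le> B"
    using compact_imp_bounded bounded_iff by (metis imageI)
  show ?thesis
  proof (rule integrableI_bounded_set[where A = "cball 0 R" and B = "max 0 B"])
    show "AE z in lborel. z \<in> cball 0 R \<longrightarrow> norm (v z *\<^sub>R f z) \<le> max 0 B"
    proof (intro AE_I2 impI)
      fix z :: complex assume "z \<in> cball 0 R"
      then have "v z * norm (f z) \<le> 1 * B"
        using v_bounds[of z] B[of z] by (intro mult_mono) auto
      then show "norm (v z *\<^sub>R f z) \<le> max 0 B" using v_bounds(1)[of z] by simp
    qed
    show "AE z in lborel. z \<notin> cball 0 R \<longrightarrow> v z *\<^sub>R f z = 0"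
      by (simp add: v_support)
  qed (use emeasure_bounded_finite[OF bounded_cball] in simp_all)
qed

text \<open>Rotation by the angle pi / (n - m) preserves the measure and negates the
  integrand.\<close>

lemma weighted_monomials_orthogonal:
  assumes "n \<noteq> m"
  shows "(\<integral>z. v z *\<^sub>R (z ^ n * cnj z ^ m) \<partial>lborel) = 0"
proof -
  define w where "w = cis (pi / (real n - real m))"
  let ?f = "\<lambda>z. v z *\<^sub>R (z ^ n * cnj z ^ m)"
  have w: "cmod w = 1" by (simp add: w_def)
  have "w ^ n * cnj w ^ m = cis (real n * (pi / (real n - real m)) - real m * (pi / (real n - real m)))"
    by (simp add: w_def cis_cnj Complex.DeMoivre cis_mult)
  also have "real n * (pi / (real n - real m)) - real m * (pi / (real n - real m)) = pi"
    using assms by (simp add: field_simps flip: diff_divide_distrib)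
  finally have wnm: "w ^ n * cnj w ^ m = - 1" by simp
  have [measurable]: "?f \<in> borel_measurable borel"
    by (intro borel_measurable_scaleR v_meas borel_measurable_continuous_onI continuous_intros)
  have "(\<integral>z. ?f z \<partial>lborel) = (\<integral>z. ?f z \<partial>distr lborel borel ((*) w))"
    by (simp add: lborel_rotate w)
  also have "\<dots> = (\<integral>z. ?f (w * z) \<partial>lborel)"
    by (rule integral_distr) auto
  also have "\<dots> = (\<integral>z. - ?f z \<partial>lborel)"
  proof (rule Bochner_Integration.integral_cong[OF refl])
    fix z
    have "(w * z) ^ n * cnj (w * z) ^ m = (w ^ n * cnj w ^ m) * (z ^ n * cnj z ^ m)"
      by (simp add: power_mult_distrib)
    then show "?f (w * z) = - ?f z"
      unfolding wnm using v_rotate[OF w, of z] by simp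
  qed
  finally show ?thesis by simp
qed

text \<open>Bounded support keeps every integral finite and bounds the partial sums uniformly, so
  the polynomial identity passes to the limit by dominated convergence. The Gaussian is reached
  afterwards by enlarging the support.\<close>

lemma weighted_parseval:
  assumes g: "\<And>z. (\<lambda>n. c n * z ^ n) sums g z"
  shows "(\<lambda>n. (cmod (c n))\<^sup>2 * (\<integral>z. v z *\<^sub>R (cmod z)\<^sup>2 ^ n \<partial>lborel)) sums
    (\<integral>z. v z *\<^sub>R (cmod (g z))\<^sup>2 \<partial>lborel)"
proof -
  define p where "p N z = (\<Sum>n<N. c n * z ^ n)" for N z
  have p_cont: "continuous_on UNIV (p N)" for N
    unfolding p_def by (intro continuous_intros)
  have poly: "(\<integral>z. v z *\<^sub>R (cmod (p N z))\<^sup>2 \<partial>lborel) =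
      (\<Sum>n<N. (cmod (c n))\<^sup>2 * (\<integral>z. v z *\<^sub>R (cmod z)\<^sup>2 ^ n \<partial>lborel))" for N
  proof -
    have mono: "integrable lborel (\<lambda>z. v z *\<^sub>R (z ^ n * cnj z ^ m))" for n m
      by (intro integrable_weight continuous_intros)
    have diag: "(\<integral>z. v z *\<^sub>R (z ^ n * cnj z ^ n) \<partial>lborel) =
        complex_of_real (\<integral>z. v z *\<^sub>R (cmod z)\<^sup>2 ^ n \<partial>lborel)" for n
    proof -
      have "v z *\<^sub>R (z ^ n * cnj z ^ n) = complex_of_real (v z *\<^sub>R (cmod z)\<^sup>2 ^ n)" for z
        unfolding power_mult_distrib[symmetric] complex_norm_square[symmetric]
        by (simp add: scaleR_conv_of_real)
      then show ?thesis by (simp only: integral_complex_of_real)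
    qed
    have "complex_of_real (\<integral>z. v z *\<^sub>R (cmod (p N z))\<^sup>2 \<partial>lborel) =
        (\<integral>z. (\<Sum>n<N. \<Sum>m<N. (c n * cnj (c m)) * (v z *\<^sub>R (z ^ n * cnj z ^ m))) \<partial>lborel)"
      unfolding integral_complex_of_real[symmetric]
    proof (rule Bochner_Integration.integral_cong[OF refl])
      fix z
      show "complex_of_real (v z *\<^sub>R (cmod (p N z))\<^sup>2) =
          (\<Sum>n<N. \<Sum>m<N. (c n * cnj (c m)) * (v z *\<^sub>R (z ^ n * cnj z ^ m)))"
        unfolding real_scaleR_def of_real_mult complex_norm_square p_def cnj_sum sum_product
        unfolding sum_distrib_left
        by (intro sum.cong refl) (simp add: scaleR_conv_of_real)
    qed
    also have "\<dots> = (\<Sum>n<N. \<Sum>m<N. (c n * cnj (c m)) * (\<integral>z. v z *\<^sub>R (z ^ n * cnj z ^ m) \<partial>lborel))"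
    proof -
      have "integrable lborel (\<lambda>z. (c n * cnj (c m)) * (v z *\<^sub>R (z ^ n * cnj z ^ m)))" for n m
        by (intro integrable_mult_right mono)
      then show ?thesis
        by (simp only: Bochner_Integration.integral_sum Bochner_Integration.integrable_sum
            integral_mult_right_zero)
    qed
    also have "\<dots> = (\<Sum>n<N. \<Sum>m<N. if m = n then (c n * cnj (c n)) *
        complex_of_real (\<integral>z. v z *\<^sub>R (cmod z)\<^sup>2 ^ n \<partial>lborel) else 0)"
      by (intro sum.cong refl) (auto simp: weighted_monomials_orthogonal diag)
    also have "\<dots> = (\<Sum>n<N. (c n * cnj (c n)) * complex_of_real (\<integral>z. v z *\<^sub>R (cmod z)\<^sup>2 ^ n \<partial>lborel))"
      by (intro sum.cong refl) (simp add: sum.delta)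
    also have "\<dots> = complex_of_real (\<Sum>n<N. (cmod (c n))\<^sup>2 * (\<integral>z. v z *\<^sub>R (cmod z)\<^sup>2 ^ n \<partial>lborel))"
      unfolding of_real_sum of_real_mult complex_norm_square ..
    finally show ?thesis by (simp only: of_real_eq_iff)
  qed
  define B where "B = (\<Sum>n. norm (c n * complex_of_real \<bar>R\<bar> ^ n))"
  \<comment> \<open>Absolute convergence at radius |R| follows from convergence at the larger radius
    |R| + 1.\<close>
  have summ: "summable (\<lambda>n. norm (c n * complex_of_real \<bar>R\<bar> ^ n))"
    using g[of "of_real (\<bar>R\<bar> + 1)"] by (intro powser_insidea[of c "of_real (\<bar>R\<bar> + 1)"]) (auto simp: sums_iff)
  have B0: "0 \<le> B" unfolding B_def by (intro suminf_nonneg summ) auto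
  have pB: "norm (p N z) \<le> B" if "cmod z \<le> R" for N z
  proof -
    have "norm (p N z) \<le> (\<Sum>n<N. norm (c n * z ^ n))" unfolding p_def by (rule norm_sum)
    also have "\<dots> \<le> (\<Sum>n<N. norm (c n * complex_of_real \<bar>R\<bar> ^ n))"
      using that by (intro sum_mono) (auto simp: norm_mult norm_power intro!: mult_left_mono power_mono)
    also have "\<dots> \<le> B" unfolding B_def by (intro sum_le_suminf summ) auto
    finally show ?thesis .
  qed
  have lim: "(\<lambda>N. p N z) \<longlonglongrightarrow> g z" for z
    using g[of z] by (simp add: p_def sums_def)
  have [measurable]: "p N \<in> borel_measurable borel" for N
    by (intro borel_measurable_continuous_onI p_cont)
  have [measurable]: "g \<in> borel_measurable borel"
    using lim by (rule borel_measurable_LIMSEQ_metric[rotated]) auto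
  have "(\<lambda>N. \<integral>z. v z *\<^sub>R (cmod (p N z))\<^sup>2 \<partial>lborel) \<longlonglongrightarrow> (\<integral>z. v z *\<^sub>R (cmod (g z))\<^sup>2 \<partial>lborel)"
  proof (rule integral_dominated_convergence[where w = "\<lambda>z. v z *\<^sub>R B\<^sup>2"])
    show "integrable lborel (\<lambda>z. v z *\<^sub>R B\<^sup>2)" by (intro integrable_weight continuous_intros)
    show "AE z in lborel. (\<lambda>N. v z *\<^sub>R (cmod (p N z))\<^sup>2) \<longlonglongrightarrow> v z *\<^sub>R (cmod (g z))\<^sup>2"
      by (intro AE_I2 tendsto_intros lim)
    fix N
    show "AE z in lborel. norm (v z *\<^sub>R (cmod (p N z))\<^sup>2) \<le> v z *\<^sub>R B\<^sup>2"
    proof (rule AE_I2)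
      fix z
      show "norm (v z *\<^sub>R (cmod (p N z))\<^sup>2) \<le> v z *\<^sub>R B\<^sup>2"
      proof (cases "cmod z \<le> R")
        case True
        then show ?thesis
          using v_bounds(1)[of z] by (auto intro!: mult_left_mono power_mono pB)
      qed (simp add: v_support)
    qed
  qed auto
  then show ?thesis
    unfolding poly sums_def .
qed

end

section \<open>Gaussian moments and Gaussian norms of entire functions\<close>

lemma distr_cmod_square:
  "distr lborel borel (\<lambda>z::complex. (cmod z)\<^sup>2) = density lborel (\<lambda>x. ennreal (pi * indicator {0..} x))"
proof (rule measure_eqI_generator_eq[where E = "range lessThan" and \<Omega> = UNIV and A = "\<lambda>i. {..<real i}"])
  have m: "emeasure (distr lborel borel (\<lambda>z::complex. (cmod z)\<^sup>2)) {..<x} = ennreal (pi * max 0 x)" for x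
  proof -
    have "(cmod z)\<^sup>2 < x \<longleftrightarrow> cmod z < sqrt x" for z
      using real_sqrt_less_iff[of "(cmod z)\<^sup>2" x] by simp
    then have "(\<lambda>z::complex. (cmod z)\<^sup>2) -` {..<x} = ball 0 (sqrt x)"
      by auto
    then have "emeasure (distr lborel borel (\<lambda>z::complex. (cmod z)\<^sup>2)) {..<x} =
        emeasure lborel (ball (0::complex) (sqrt x))"
      by (simp add: emeasure_distr)
    also have "\<dots> = ennreal (pi * max 0 x)"
    proof (cases "0 \<le> x")
      case True
      then show ?thesis by (simp add: emeasure_ball unit_ball_vol_2)
    next
      case False
      \<comment> \<open>The real square root is an odd function, hence negative here, and the ball
        is empty.\<close>
      then have "sqrt x \<le> 0" by simp
      then have empty: "ball (0::complex) (sqrt x) = {}" by (simp add: ball_eq_empty)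
      show ?thesis unfolding empty using False by simp
    qed
    finally show ?thesis .
  qed
  have d: "emeasure (density lborel (\<lambda>x. ennreal (pi * indicator {0..} x))) {..<x} = ennreal (pi * max 0 x)" for x
  proof -
    have "emeasure (density lborel (\<lambda>x. ennreal (pi * indicator {0..} x))) {..<x} =
        (\<integral>\<^sup>+y. ennreal pi * indicator {0..<x} y \<partial>lborel)"
      by (subst emeasure_density) (auto intro!: nn_integral_cong simp: indicator_def)
    also have "\<dots> = ennreal pi * ennreal (max 0 x)"
      by (subst nn_integral_cmult_indicator) (auto simp: max_def)
    also have "\<dots> = ennreal (pi * max 0 x)" by (simp add: ennreal_mult)
    finally show ?thesis .
  qed
  show "emeasure (distr lborel borel (\<lambda>z::complex. (cmod z)\<^sup>2)) X =
      emeasure (density lborel (\<lambda>x. ennreal (pi * indicator {0..} x))) X"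
    if "X \<in> range lessThan" for X
    using that m d by auto
  show "emeasure (distr lborel borel (\<lambda>z::complex. (cmod z)\<^sup>2)) {..<real i} \<noteq> \<infinity>" for i
    unfolding m by simp
  show "Int_stable (range (lessThan :: real \<Rightarrow> real set))"
  proof -
    have "{..<x} \<inter> {..<y} = {..<min x y}" for x y :: real by auto
    then show ?thesis unfolding Int_stable_def by auto
  qed
  show "(\<Union>i. {..<real i}) = UNIV"
    using reals_Archimedean2 by auto
qed (auto simp: borel_Iio)

text \<open>The squared modulus has constant density pi on the half line, which leaves a moment of
  the exponential distribution of rate t, the Erlang density of order 0.\<close>

lemma nn_integral_cmod_power_exp:
  assumes t: "0 < t"
  shows "(\<integral>\<^sup>+z. ennreal ((cmod z)\<^sup>2 ^ n * exp (- t * (cmod z)\<^sup>2)) \<partial>lborel) =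
    ennreal (pi * fact n / t ^ Suc n)"
proof -
  let ?h = "\<lambda>x::real. ennreal (x ^ n * exp (- t * x))"
  have "(\<integral>\<^sup>+z. ?h ((cmod z)\<^sup>2) \<partial>lborel) =
      (\<integral>\<^sup>+x. ?h x \<partial>distr lborel borel (\<lambda>z::complex. (cmod z)\<^sup>2))"
    by (subst nn_integral_distr) auto
  also have "\<dots> = (\<integral>\<^sup>+x. ennreal (pi * indicator {0..} x) * ?h x \<partial>lborel)"
    unfolding distr_cmod_square by (subst nn_integral_density) auto
  also have "\<dots> = (\<integral>\<^sup>+x. ennreal (pi / t) * ennreal (erlang_density 0 t x * x ^ n) \<partial>lborel)"
    using t by (intro nn_integral_cong)
      (auto simp: erlang_density_def indicator_def simp flip: ennreal_mult)
  also have "\<dots> = ennreal (pi / t) * ennreal (fact n / t ^ n)"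
    using nn_integral_erlang_ith_moment[OF t, of 0 n] by (subst nn_integral_cmult) auto
  also have "\<dots> = ennreal (pi * fact n / t ^ Suc n)"
    using t by (simp flip: ennreal_mult)
  finally show ?thesis .
qed

text \<open>Monotone convergence, read as continuity from below of the measures with densities f and
  g.\<close>

lemma nn_integral_eq_if_eq_on_cballs:
  fixes f g :: "'a::euclidean_space \<Rightarrow> ennreal"
  assumes [measurable]: "f \<in> borel_measurable borel" "g \<in> borel_measurable borel"
    and eq: "\<And>k::nat. (\<integral>\<^sup>+z. f z * indicator (cball 0 (real k)) z \<partial>lborel) =
      (\<integral>\<^sup>+z. g z * indicator (cball 0 (real k)) z \<partial>lborel)"
  shows "(\<integral>\<^sup>+z. f z \<partial>lborel) = (\<integral>\<^sup>+z. g z \<partial>lborel)"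
proof -
  have *: "(\<integral>\<^sup>+z. h z \<partial>lborel) = (SUP k::nat. \<integral>\<^sup>+z. h z * indicator (cball 0 (real k)) z \<partial>lborel)"
    if [measurable]: "h \<in> borel_measurable borel" for h :: "'a \<Rightarrow> ennreal"
  proof -
    have U: "(\<Union>k. cball (0::'a) (real k)) = UNIV"
      using real_arch_simple by auto
    have "(SUP k::nat. emeasure (density lborel h) (cball 0 (real k))) =
        emeasure (density lborel h) (\<Union>k. cball 0 (real k))"
      by (intro SUP_emeasure_incseq) (auto simp: incseq_def)
    then show ?thesis
      unfolding U by (simp add: emeasure_density)
  qed
  show ?thesis
    unfolding *[OF assms(1)] *[OF assms(2)] eq ..
qed

text \<open>Extended values let the same formula decide whether a norm or moment is finite. The
  parameter t is 1 for the mass and the second moment, 2 for the fourth power.\<close>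

lemma nn_integral_entire_gaussian:
  assumes g: "\<And>z. (\<lambda>n. c n * z ^ n) sums g z" and hol: "g holomorphic_on UNIV" and t: "0 < t"
  shows "(\<integral>\<^sup>+z. ennreal ((cmod (g z))\<^sup>2 * exp (- t * (cmod z)\<^sup>2)) \<partial>lborel) =
    (\<Sum>n. ennreal ((cmod (c n))\<^sup>2 * (pi * fact n / t ^ Suc n)))"
proof -
  have g_cont: "continuous_on UNIV g" using hol by (rule holomorphic_on_imp_continuous_on)
  have [measurable]: "g \<in> borel_measurable borel"
    by (rule borel_measurable_continuous_onI[OF g_cont])
  have "(\<integral>\<^sup>+z. ennreal ((cmod (g z))\<^sup>2 * exp (- t * (cmod z)\<^sup>2)) \<partial>lborel) =
    (\<integral>\<^sup>+z. (\<Sum>n. ennreal ((cmod (c n))\<^sup>2 * ((cmod z)\<^sup>2 ^ n * exp (- t * (cmod z)\<^sup>2)))) \<partial>lborel)"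
  proof (rule nn_integral_eq_if_eq_on_cballs)
    fix k :: nat
    define v where "v z = indicator (cball 0 (real k)) z * exp (- t * (cmod z)\<^sup>2)" for z :: complex
    have v_meas [measurable]: "v \<in> borel_measurable borel" unfolding v_def
      by (intro borel_measurable_times borel_measurable_indicator borel_measurable_continuous_onI
          continuous_intros) auto
    have [measurable]: "(indicator (cball 0 (real k)) :: complex \<Rightarrow> ennreal) \<in> borel_measurable borel"
      by (intro borel_measurable_indicator) simp
    have v0: "0 \<le> v z" for z by (simp add: v_def)
    have vI: "integrable lborel (\<lambda>z. v z *\<^sub>R f z)" if "continuous_on UNIV f" for f :: "complex \<Rightarrow> real"
      by (rule integrable_weight[where R = "real k"])
         (use t that in \<open>auto simp: v_def norm_mult indicator_def\<close>)
    have eq: "(\<integral>\<^sup>+z. ennreal (f z * exp (- t * (cmod z)\<^sup>2)) * indicator (cball 0 (real k)) z \<partial>lborel) =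
        ennreal (\<integral>z. v z *\<^sub>R f z \<partial>lborel)"
      if "continuous_on UNIV f" "\<And>z. 0 \<le> f z" for f
      using that by (subst nn_integral_eq_integral[symmetric, OF vI])
        (auto intro!: nn_integral_cong simp: v_def indicator_def mult.commute)
    have sums: "(\<lambda>n. (cmod (c n))\<^sup>2 * (\<integral>z. v z *\<^sub>R (cmod z)\<^sup>2 ^ n \<partial>lborel)) sums
        (\<integral>z. v z *\<^sub>R (cmod (g z))\<^sup>2 \<partial>lborel)"
      by (rule weighted_parseval[where R = "real k"])
         (use t g in \<open>auto simp: v_def norm_mult indicator_def\<close>)
    have "(\<integral>\<^sup>+z. ennreal ((cmod (g z))\<^sup>2 * exp (- t * (cmod z)\<^sup>2)) * indicator (cball 0 (real k)) z \<partial>lborel) =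
        ennreal (\<integral>z. v z *\<^sub>R (cmod (g z))\<^sup>2 \<partial>lborel)"
      using g_cont by (intro eq continuous_intros) auto
    also have "\<dots> = (\<Sum>n. ennreal ((cmod (c n))\<^sup>2 * (\<integral>z. v z *\<^sub>R (cmod z)\<^sup>2 ^ n \<partial>lborel)))"
      using sums by (intro suminf_ennreal_eq[symmetric] mult_nonneg_nonneg integral_nonneg) (auto simp: v0)
    also have "\<dots> = (\<Sum>n. \<integral>\<^sup>+z. ennreal ((cmod (c n))\<^sup>2 * ((cmod z)\<^sup>2 ^ n * exp (- t * (cmod z)\<^sup>2)))
        * indicator (cball 0 (real k)) z \<partial>lborel)"
    proof (rule suminf_cong)
      fix n
      have "ennreal ((cmod (c n))\<^sup>2 * (\<integral>z. v z *\<^sub>R (cmod z)\<^sup>2 ^ n \<partial>lborel)) =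
          ennreal (\<integral>z. v z *\<^sub>R ((cmod (c n))\<^sup>2 * (cmod z)\<^sup>2 ^ n) \<partial>lborel)"
        by (simp add: mult.left_commute flip: integral_mult_right_zero)
      also have "\<dots> = (\<integral>\<^sup>+z. ennreal ((cmod (c n))\<^sup>2 * (cmod z)\<^sup>2 ^ n * exp (- t * (cmod z)\<^sup>2))
        * indicator (cball 0 (real k)) z \<partial>lborel)"
        by (intro eq[symmetric] continuous_intros) auto
      finally show "ennreal ((cmod (c n))\<^sup>2 * (\<integral>z. v z *\<^sub>R (cmod z)\<^sup>2 ^ n \<partial>lborel)) =
          (\<integral>\<^sup>+z. ennreal ((cmod (c n))\<^sup>2 * ((cmod z)\<^sup>2 ^ n * exp (- t * (cmod z)\<^sup>2)))
        * indicator (cball 0 (real k)) z \<partial>lborel)"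
        by (simp only: mult.assoc)
    qed
    also have "\<dots> = (\<integral>\<^sup>+z. (\<Sum>n. ennreal ((cmod (c n))\<^sup>2 * ((cmod z)\<^sup>2 ^ n * exp (- t * (cmod z)\<^sup>2)))
        * indicator (cball 0 (real k)) z) \<partial>lborel)"
      by (subst nn_integral_suminf) auto
    finally show "(\<integral>\<^sup>+z. ennreal ((cmod (g z))\<^sup>2 * exp (- t * (cmod z)\<^sup>2)) * indicator (cball 0 (real k)) z \<partial>lborel) =
      (\<integral>\<^sup>+z. (\<Sum>n. ennreal ((cmod (c n))\<^sup>2 * ((cmod z)\<^sup>2 ^ n * exp (- t * (cmod z)\<^sup>2))))
        * indicator (cball 0 (real k)) z \<partial>lborel)"
      by simp
  qed measurable
  also have "\<dots> = (\<Sum>n. \<integral>\<^sup>+z. ennreal ((cmod (c n))\<^sup>2 * ((cmod z)\<^sup>2 ^ n * exp (- t * (cmod z)\<^sup>2))) \<partial>lborel)"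
    by (subst nn_integral_suminf) auto
  also have "\<dots> = (\<Sum>n. ennreal ((cmod (c n))\<^sup>2 * (pi * fact n / t ^ Suc n)))"
  proof (rule suminf_cong)
    fix n
    have "(\<integral>\<^sup>+z. ennreal ((cmod (c n))\<^sup>2 * ((cmod z)\<^sup>2 ^ n * exp (- t * (cmod z)\<^sup>2))) \<partial>lborel) =
        (\<integral>\<^sup>+z. ennreal ((cmod (c n))\<^sup>2) * ennreal ((cmod z)\<^sup>2 ^ n * exp (- t * (cmod z)\<^sup>2)) \<partial>lborel)"
      by (intro nn_integral_cong ennreal_mult) auto
    also have "\<dots> = ennreal ((cmod (c n))\<^sup>2) * ennreal (pi * fact n / t ^ Suc n)"
      by (subst nn_integral_cmult) (auto simp: nn_integral_cmod_power_exp[OF t, simplified])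
    also have "\<dots> = ennreal ((cmod (c n))\<^sup>2 * (pi * fact n / t ^ Suc n))"
      using t by (intro ennreal_mult[symmetric]) auto
    finally show "(\<integral>\<^sup>+z. ennreal ((cmod (c n))\<^sup>2 * ((cmod z)\<^sup>2 ^ n * exp (- t * (cmod z)\<^sup>2))) \<partial>lborel) =
      ennreal ((cmod (c n))\<^sup>2 * (pi * fact n / t ^ Suc n))" .
  qed
  finally show ?thesis .
qed

section \<open>Bargmann-Fock functions and the minimization problem\<close>

text \<open>pi n! is the squared norm of z^n for the weight exp (- |z|^2), so these are coordinates
  in the orthonormal basis.\<close>

definition fock_coeff :: "(nat \<Rightarrow> complex) \<Rightarrow> nat \<Rightarrow> complex" where
  "fock_coeff c n = complex_of_real (sqrt (pi * fact n)) * c n"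

lemma cmod_fock_coeff: "(cmod (fock_coeff c n))\<^sup>2 = (cmod (c n))\<^sup>2 * (pi * fact n)"
  by (simp add: fock_coeff_def norm_mult power_mult_distrib)

lemma suminf_ennreal_finite:
  assumes "\<And>n. 0 \<le> f n" "(\<Sum>n. ennreal (f n)) < \<infinity>"
  shows "summable f" "(\<Sum>n. ennreal (f n)) = ennreal (suminf f)"
proof -
  show "summable f"
    using assms by (intro summable_suminf_not_top) auto
  then show "(\<Sum>n. ennreal (f n)) = ennreal (suminf f)"
    using assms(1) by (intro suminf_ennreal2) auto
qed

locale fock_expansion =
  fixes u f :: "complex \<Rightarrow> complex" and c :: "nat \<Rightarrow> complex"
  assumes hol: "f holomorphic_on UNIV"
    and expansion: "\<And>z. (\<lambda>n. c n * z ^ n) sums f z"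
    and u_def: "u = (\<lambda>z. complex_of_real (exp (- (cmod z)\<^sup>2 / 2)) * f z)"
begin

abbreviation coeff :: "nat \<Rightarrow> complex" where "coeff \<equiv> fock_coeff c"

lemma u_measurable [measurable]: "u \<in> borel_measurable borel"
  unfolding u_def
  by (intro borel_measurable_continuous_onI continuous_intros
      holomorphic_on_imp_continuous_on[OF hol]) simp

lemma cmod_u_square: "(cmod (u z))\<^sup>2 = (cmod (f z))\<^sup>2 * exp (- 1 * (cmod z)\<^sup>2)"
  by (simp add: u_def norm_mult power_mult_distrib mult.commute flip: exp_double)

lemma nn_integral_mass: "(\<integral>\<^sup>+z. ennreal ((cmod (u z))\<^sup>2) \<partial>lborel) = (\<Sum>n. ennreal ((cmod (coeff n))\<^sup>2))"
  unfolding cmod_u_square nn_integral_entire_gaussian[OF expansion hol zero_less_one]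
  by (simp add: cmod_fock_coeff)

text \<open>Multiplying f by z shifts its coefficients, and (n + 1)! / n! produces the factor n + 1;
  the - 1 in \<open>momentum_P\<close> turns it into the weight n of
  \<open>momentum\<close>.\<close>

lemma nn_integral_second_moment:
  "(\<integral>\<^sup>+z. ennreal ((cmod z)\<^sup>2 * (cmod (u z))\<^sup>2) \<partial>lborel) =
     (\<Sum>n. ennreal (real (Suc n) * (cmod (coeff n))\<^sup>2))"
proof -
  let ?d = "\<lambda>n. case n of 0 \<Rightarrow> 0 | Suc m \<Rightarrow> c m"
  have "(\<lambda>n. ?d n * z ^ n) sums (z * f z)" for z
  proof -
    have "(\<lambda>n. z * (c n * z ^ n)) sums (z * f z)"
      by (intro sums_mult expansion)
    then have "(\<lambda>n. ?d (Suc n) * z ^ Suc n) sums (z * f z)"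
      by (simp add: mult_ac)
    from sums_Suc[OF this] show ?thesis by simp
  qed
  moreover have "(\<lambda>z. z * f z) holomorphic_on UNIV"
    using hol by (intro holomorphic_intros)
  ultimately have "(\<integral>\<^sup>+z. ennreal ((cmod (z * f z))\<^sup>2 * exp (- 1 * (cmod z)\<^sup>2)) \<partial>lborel) =
      (\<Sum>n. ennreal ((cmod (?d n))\<^sup>2 * (pi * fact n / 1 ^ Suc n)))"
    by (rule nn_integral_entire_gaussian) simp
  also have "\<dots> = (\<Sum>n. ennreal ((cmod (?d (Suc n)))\<^sup>2 * (pi * fact (Suc n) / 1 ^ Suc (Suc n))))"
    by (subst suminf_offset[where i = 1]) (auto intro: summableI)
  also have "\<dots> = (\<Sum>n. ennreal (real (Suc n) * (cmod (coeff n))\<^sup>2))"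
    by (simp add: cmod_fock_coeff mult_ac)
  finally show ?thesis
    unfolding cmod_u_square by (simp add: norm_mult power_mult_distrib mult_ac)
qed

text \<open>The convolution is the k-th coefficient of f^2, the middle factor the Gaussian norm of
  z^k at t = 2, and 2 pi is 8 pi times the 1 / 4 in \<open>energy_H\<close>.\<close>

lemma level_contact_coeff:
  "level_contact coeff k = (cmod (\<Sum>i\<le>k. c i * c (k - i)))\<^sup>2 * (pi * fact k / 2 ^ Suc k) * (2 * pi)"
proof -
  have "of_nat (k choose j) * pair_level coeff k j =
      complex_of_real (pi * fact k) * (c j * c (k - j))" if "j \<le> k" for j
  proof -
    have "complex_of_real (sqrt (fact j)) * complex_of_real (sqrt (fact j)) = fact j" for j :: nat
      by (simp flip: of_real_mult)
    moreover have "complex_of_real (sqrt pi) * complex_of_real (sqrt pi) = complex_of_real pi"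
      by (simp flip: of_real_mult)
    ultimately have "pair_level coeff k j = complex_of_real pi * (fact j * fact (k - j)) * (c j * c (k - j))"
      by (simp add: pair_level_def taylor_def fock_coeff_def real_sqrt_mult mult_ac)
    moreover have "of_nat (k choose j) * (fact j * fact (k - j)) = (fact k :: complex)"
      using binomial_fact_lemma[OF that] by (metis of_nat_fact of_nat_mult mult.commute)
    ultimately show ?thesis
      by (simp add: mult_ac)
  qed
  then have "binomial_avg k (pair_level coeff k) =
      complex_of_real (pi * fact k) * (\<Sum>i\<le>k. c i * c (k - i)) / 2 ^ k"
    unfolding binomial_avg_eq_sum sum_distrib_left by (intro arg_cong2[where f = "(/)"] sum.cong) auto
  then have "(cmod (binomial_avg k (pair_level coeff k)))\<^sup>2 =
      (pi * fact k)\<^sup>2 * (cmod (\<Sum>i\<le>k. c i * c (k - i)))\<^sup>2 / (2 ^ k)\<^sup>2"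
    by (simp add: norm_mult norm_divide norm_power power_mult_distrib power_divide)
  then show ?thesis
    by (simp add: level_contact_def level_weight_def power2_eq_square field_simps)
qed

lemma nn_integral_fourth:
  "ennreal (2 * pi) * (\<integral>\<^sup>+z. ennreal (cmod (u z) ^ 4) \<partial>lborel) = (\<Sum>k. ennreal (level_contact coeff k))"
proof -
  have sq: "(\<lambda>k. (\<Sum>i\<le>k. c i * c (k - i)) * z ^ k) sums (f z * f z)" for z
  proof -
    have "summable (\<lambda>n. norm (c n * z ^ n))"
    proof (rule powser_insidea)
      show "summable (\<lambda>n. c n * complex_of_real (cmod z + 1) ^ n)"
        by (rule sums_summable[OF expansion])
      show "norm z < norm (complex_of_real (cmod z + 1))"
        unfolding norm_of_real by simp
    qed
    from Cauchy_product_sums[OF this this]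
    have "(\<lambda>k. \<Sum>i\<le>k. c i * z ^ i * (c (k - i) * z ^ (k - i))) sums (f z * f z)"
      using expansion[of z] by (simp add: sums_iff)
    also have "(\<lambda>k. \<Sum>i\<le>k. c i * z ^ i * (c (k - i) * z ^ (k - i))) =
        (\<lambda>k. (\<Sum>i\<le>k. c i * c (k - i)) * z ^ k)"
    proof
      fix k
      have eq: "c i * z ^ i * (c (k - i) * z ^ (k - i)) = c i * c (k - i) * z ^ k" if "i \<le> k" for i
      proof -
        have "z ^ k = z ^ i * z ^ (k - i)" using that by (simp flip: power_add)
        then show ?thesis by simp
      qed
      show "(\<Sum>i\<le>k. c i * z ^ i * (c (k - i) * z ^ (k - i))) = (\<Sum>i\<le>k. c i * c (k - i)) * z ^ k"
        unfolding sum_distrib_right by (intro sum.cong refl) (simp only: eq atMost_iff)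
    qed
    finally show ?thesis .
  qed
  have hol2: "(\<lambda>z. f z * f z) holomorphic_on UNIV" using hol by (intro holomorphic_intros)
  have gauss: "(\<integral>\<^sup>+z. ennreal ((cmod (f z * f z))\<^sup>2 * exp (- 2 * (cmod z)\<^sup>2)) \<partial>lborel) =
      (\<Sum>k. ennreal ((cmod (\<Sum>i\<le>k. c i * c (k - i)))\<^sup>2 * (pi * fact k / 2 ^ Suc k)))"
    by (rule nn_integral_entire_gaussian[OF sq hol2]) simp
  have fourth: "cmod (u z) ^ 4 = (cmod (f z * f z))\<^sup>2 * exp (- 2 * (cmod z)\<^sup>2)" for z
  proof -
    have "cmod (u z) ^ 4 = ((cmod (u z))\<^sup>2)\<^sup>2" by simp
    also have "\<dots> = (cmod (f z * f z))\<^sup>2 * (exp (- 1 * (cmod z)\<^sup>2))\<^sup>2"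
      unfolding cmod_u_square by (simp add: norm_mult power2_eq_square mult_ac)
    also have "(exp (- 1 * (cmod z)\<^sup>2))\<^sup>2 = exp (- 2 * (cmod z)\<^sup>2)"
      by (simp flip: exp_double)
    finally show ?thesis .
  qed
  have "ennreal (2 * pi) * (\<integral>\<^sup>+z. ennreal (cmod (u z) ^ 4) \<partial>lborel) =
      (\<Sum>k. ennreal (2 * pi) * ennreal ((cmod (\<Sum>i\<le>k. c i * c (k - i)))\<^sup>2 * (pi * fact k / 2 ^ Suc k)))"
    unfolding fourth gauss by (rule ennreal_suminf_cmult[symmetric])
  also have "\<dots> = (\<Sum>k. ennreal (level_contact coeff k))"
    unfolding level_contact_coeff by (intro suminf_cong) (simp add: mult_ac flip: ennreal_mult)
  finally show ?thesis .
qed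

lemma integrable_iff: "u \<in> L2_complex \<longleftrightarrow> square_summable coeff"
proof
  assume "u \<in> L2_complex"
  then have "(\<integral>\<^sup>+z. ennreal ((cmod (u z))\<^sup>2) \<partial>lborel) < \<infinity>"
    unfolding L2_complex_def by (auto simp: integrable_iff_bounded)
  then show "square_summable coeff"
    unfolding square_summable_def nn_integral_mass by (intro suminf_ennreal_finite) auto
next
  assume "square_summable coeff"
  then have "(\<integral>\<^sup>+z. ennreal ((cmod (u z))\<^sup>2) \<partial>lborel) = ennreal (norm_sq coeff)"
    unfolding nn_integral_mass norm_sq_def square_summable_def by (intro suminf_ennreal2) auto
  then show "u \<in> L2_complex"
    unfolding L2_complex_def by (auto simp: integrable_iff_bounded)
qed

lemma bargmann_fock_iff: "u \<in> bargmann_fock \<longleftrightarrow> square_summable coeff"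
  using integrable_iff hol u_def unfolding bargmann_fock_def by blast

context
  assumes ss: "square_summable coeff"
begin

lemma mass_eq: "mass_M u = norm_sq coeff"
proof -
  have "(\<integral>\<^sup>+z. ennreal ((cmod (u z))\<^sup>2) \<partial>lborel) = ennreal (norm_sq coeff)"
    using ss unfolding nn_integral_mass norm_sq_def square_summable_def by (intro suminf_ennreal2) auto
  then show ?thesis
    unfolding mass_M_def by (subst integral_eq_nn_integral) (auto simp: norm_sq_nonneg ss)
qed

lemma energy_eq: "8 * pi * energy_H u = contact_energy coeff"
proof -
  have fin: "(\<Sum>k. ennreal (level_contact coeff k)) = ennreal (contact_energy coeff)"
    unfolding contact_energy_def
    by (intro suminf_ennreal2 summable_level_contact ss level_contact_nonneg)
  have "(\<integral>z. cmod (u z) ^ 4 \<partial>lborel) = enn2real (\<integral>\<^sup>+z. ennreal (cmod (u z) ^ 4) \<partial>lborel)"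
    by (rule integral_eq_nn_integral) auto
  then have "2 * pi * (\<integral>z. cmod (u z) ^ 4 \<partial>lborel) =
      enn2real (ennreal (2 * pi) * (\<integral>\<^sup>+z. ennreal (cmod (u z) ^ 4) \<partial>lborel))"
    by (simp add: enn2real_mult)
  also have "\<dots> = contact_energy coeff"
    unfolding nn_integral_fourth fin by (simp add: contact_energy_nonneg ss)
  finally show ?thesis
    by (simp add: energy_H_def)
qed

text \<open>Stated additively because \<open>I\<^sub>p\<close> may be infinite.\<close>

lemma momentum_parts:
  defines "I\<^sub>p \<equiv> \<integral>\<^sup>+z. ennreal (((cmod z)\<^sup>2 - 1) * (cmod (u z))\<^sup>2) \<partial>lborel"
    and "I\<^sub>n \<equiv> \<integral>\<^sup>+z. ennreal (- (((cmod z)\<^sup>2 - 1) * (cmod (u z))\<^sup>2)) \<partial>lborel"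
  shows "I\<^sub>p + ennreal (norm_sq coeff) = (\<Sum>n. ennreal (real (Suc n) * (cmod (coeff n))\<^sup>2)) + I\<^sub>n"
    and "I\<^sub>n \<le> ennreal (norm_sq coeff)"
proof -
  have m: "(\<integral>\<^sup>+z. ennreal ((cmod (u z))\<^sup>2) \<partial>lborel) = ennreal (norm_sq coeff)"
    using ss unfolding nn_integral_mass norm_sq_def square_summable_def by (intro suminf_ennreal2) auto
  have split: "ennreal ((x - 1) * y) + ennreal y = ennreal (x * y) + ennreal (- ((x - 1) * y))"
    if "0 \<le> x" "0 \<le> y" for x y :: real
  proof (cases "1 \<le> x")
    case True
    then have "0 \<le> (x - 1) * y" using that by simp
    then show ?thesis using that by (simp add: ennreal_neg algebra_simps flip: ennreal_plus)
  next
    case False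
    then have "(x - 1) * y \<le> 0" using that by (simp add: mult_nonpos_nonneg)
    then show ?thesis using that by (simp add: ennreal_neg algebra_simps flip: ennreal_plus)
  qed
  have "I\<^sub>p + ennreal (norm_sq coeff) =
      (\<integral>\<^sup>+z. ennreal (((cmod z)\<^sup>2 - 1) * (cmod (u z))\<^sup>2) + ennreal ((cmod (u z))\<^sup>2) \<partial>lborel)"
    unfolding I\<^sub>p_def m[symmetric] by (subst nn_integral_add) auto
  also have "\<dots> = (\<integral>\<^sup>+z. ennreal ((cmod z)\<^sup>2 * (cmod (u z))\<^sup>2) +
      ennreal (- (((cmod z)\<^sup>2 - 1) * (cmod (u z))\<^sup>2)) \<partial>lborel)"
    by (subst split) auto
  also have "\<dots> = (\<Sum>n. ennreal (real (Suc n) * (cmod (coeff n))\<^sup>2)) + I\<^sub>n"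
    unfolding I\<^sub>n_def nn_integral_second_moment[symmetric] by (subst nn_integral_add) auto
  finally show "I\<^sub>p + ennreal (norm_sq coeff) = (\<Sum>n. ennreal (real (Suc n) * (cmod (coeff n))\<^sup>2)) + I\<^sub>n" .
  show "I\<^sub>n \<le> ennreal (norm_sq coeff)"
    unfolding I\<^sub>n_def m[symmetric]
  proof (intro nn_integral_mono ennreal_leI)
    show "- (((cmod z)\<^sup>2 - 1) * (cmod (u z))\<^sup>2) \<le> (cmod (u z))\<^sup>2" for z
      using mult_nonneg_nonneg[of "(cmod z)\<^sup>2" "(cmod (u z))\<^sup>2"] by (simp add: algebra_simps)
  qed
qed

lemma momentum_P_finite:
  assumes "summable (\<lambda>n. real n * (cmod (coeff n))\<^sup>2)"
  shows "momentum_P u = ereal (momentum coeff)"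
proof -
  define I\<^sub>p where "I\<^sub>p = (\<integral>\<^sup>+z. ennreal (((cmod z)\<^sup>2 - 1) * (cmod (u z))\<^sup>2) \<partial>lborel)"
  define I\<^sub>n where "I\<^sub>n = (\<integral>\<^sup>+z. ennreal (- (((cmod z)\<^sup>2 - 1) * (cmod (u z))\<^sup>2)) \<partial>lborel)"
  note parts = momentum_parts[folded I\<^sub>p_def I\<^sub>n_def]
  have m0: "0 \<le> momentum coeff" "0 \<le> norm_sq coeff"
    using assms ss by (auto intro!: momentum_nonneg norm_sq_nonneg simp: finite_momentum_def)
  have "(\<lambda>n. real n * (cmod (coeff n))\<^sup>2 + (cmod (coeff n))\<^sup>2) sums (momentum coeff + norm_sq coeff)"
    unfolding momentum_def norm_sq_def using assms ss
    by (intro sums_add summable_sums) (auto simp: square_summable_def)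
  then have "(\<lambda>n. real (Suc n) * (cmod (coeff n))\<^sup>2) sums (momentum coeff + norm_sq coeff)"
    by (simp add: algebra_simps)
  then have S: "(\<Sum>n. ennreal (real (Suc n) * (cmod (coeff n))\<^sup>2)) = ennreal (momentum coeff + norm_sq coeff)"
    by (intro suminf_ennreal_eq) auto
  obtain n where n: "I\<^sub>n = ennreal n" "0 \<le> n"
    using parts(2) by (cases I\<^sub>n) (auto simp: top_unique)
  have "I\<^sub>p \<le> I\<^sub>p + ennreal (norm_sq coeff)" by simp
  also have "\<dots> < \<infinity>" unfolding parts(1) S n by simp
  finally obtain p where p: "I\<^sub>p = ennreal p" "0 \<le> p"
    by (cases I\<^sub>p) auto
  have "ennreal (p + norm_sq coeff) = ennreal (momentum coeff + norm_sq coeff + n)"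
    using parts(1) unfolding S n p using m0 n(2) p(2) by (simp add: ennreal_plus)
  then have "p + norm_sq coeff = momentum coeff + norm_sq coeff + n"
    using m0 n(2) p(2) by (subst (asm) ennreal_inj) auto
  then show ?thesis
    unfolding momentum_P_def I\<^sub>p_def[symmetric] I\<^sub>n_def[symmetric] n p using n(2) p(2) by simp
qed

lemma momentum_P_infinite:
  assumes "\<not> summable (\<lambda>n. real n * (cmod (coeff n))\<^sup>2)"
  shows "momentum_P u = \<infinity>"
proof -
  define I\<^sub>p where "I\<^sub>p = (\<integral>\<^sup>+z. ennreal (((cmod z)\<^sup>2 - 1) * (cmod (u z))\<^sup>2) \<partial>lborel)"
  define I\<^sub>n where "I\<^sub>n = (\<integral>\<^sup>+z. ennreal (- (((cmod z)\<^sup>2 - 1) * (cmod (u z))\<^sup>2)) \<partial>lborel)"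
  note parts = momentum_parts[folded I\<^sub>p_def I\<^sub>n_def]
  have "(\<Sum>n. ennreal (real (Suc n) * (cmod (coeff n))\<^sup>2)) = \<infinity>"
  proof (rule ccontr)
    assume "(\<Sum>n. ennreal (real (Suc n) * (cmod (coeff n))\<^sup>2)) \<noteq> \<infinity>"
    then have "summable (\<lambda>n. real (Suc n) * (cmod (coeff n))\<^sup>2)"
      by (intro suminf_ennreal_finite) (auto simp: less_top)
    then have "summable (\<lambda>n. real n * (cmod (coeff n))\<^sup>2)"
      by (rule summable_comparison_test') (auto intro: mult_right_mono)
    with assms show False ..
  qed
  then have "I\<^sub>p + ennreal (norm_sq coeff) = top"
    using parts(1) by simp
  then have p: "I\<^sub>p = top" by simp
  obtain n where n: "I\<^sub>n = ennreal n" "0 \<le> n"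
    using parts(2) by (cases I\<^sub>n) (auto simp: top_unique)
  show ?thesis
    unfolding momentum_P_def I\<^sub>p_def[symmetric] I\<^sub>n_def[symmetric] p n(1) using n(2) by simp
qed

lemma functional_G_finite:
  assumes "finite_momentum coeff"
  shows "functional_G \<mu> u = ereal (contact_energy coeff + \<mu> * momentum coeff)"
  using assms unfolding functional_G_def energy_eq
  by (subst momentum_P_finite) (auto simp: finite_momentum_def)

lemma functional_G_infinite:
  assumes "\<not> finite_momentum coeff" "0 < \<mu>"
  shows "functional_G \<mu> u = \<infinity>"
  using assms ss unfolding functional_G_def energy_eq
  by (subst momentum_P_infinite) (auto simp: finite_momentum_def)

end

end

lemma bargmann_fock_expansion:
  assumes "u \<in> bargmann_fock"
  obtains f c where "fock_expansion u f c"
proof -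
  obtain f where f: "f holomorphic_on UNIV"
    "u = (\<lambda>z. complex_of_real (exp (- (cmod z)\<^sup>2 / 2)) * f z)"
    using assms unfolding bargmann_fock_def by blast
  have "(\<lambda>n. (deriv ^^ n) f 0 / fact n * z ^ n) sums f z" for z
    using holomorphic_power_series[of f 0 "cmod z + 1" z] holomorphic_on_subset[OF f(1)] by simp
  then have "fock_expansion u f (\<lambda>n. (deriv ^^ n) f 0 / fact n)"
    using f by unfold_locales auto
  then show thesis by (rule that)
qed

section \<open>The first mode and its phase orbit\<close>

definition unit_seq :: "nat \<Rightarrow> complex" where
  "unit_seq n = (if n = 1 then 1 else 0)"

lemma unit_seq_square_summable: "square_summable unit_seq"
  and norm_sq_unit_seq: "norm_sq unit_seq = 1"
  and finite_momentum_unit_seq: "finite_momentum unit_seq"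
  and momentum_unit_seq: "momentum unit_seq = 1"
proof -
  have "(\<lambda>n. (cmod (unit_seq n))\<^sup>2) = (\<lambda>n. if n = 1 then 1 else 0)"
    "(\<lambda>n. real n * (cmod (unit_seq n))\<^sup>2) = (\<lambda>n. if n = 1 then 1 else 0)"
    by (auto simp: unit_seq_def)
  then have "(\<lambda>n. (cmod (unit_seq n))\<^sup>2) sums 1" "(\<lambda>n. real n * (cmod (unit_seq n))\<^sup>2) sums 1"
    using sums_single[of 1 "\<lambda>_. 1 :: real"] by simp_all
  then show "square_summable unit_seq" "norm_sq unit_seq = 1"
    "finite_momentum unit_seq" "momentum unit_seq = 1"
    by (auto simp: square_summable_def norm_sq_def finite_momentum_def momentum_def sums_iff)
qed

text \<open>The tensor square of mode 1 has total degree 2, with weight 1 / 2 at m = 0 and 1 / 2 at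
  m = 2. Hence the excess of the first mode is 0.\<close>

lemma contact_energy_unit_seq: "contact_energy unit_seq = 1 / 2"
proof -
  have "level_contact unit_seq k = (if k = 2 then 1 / 2 else 0)" for k
  proof (cases "k = 2")
    case True
    show ?thesis
      by (simp add: True level_contact_def binomial_avg_eq_sum pair_level_def taylor_def unit_seq_def
          level_weight_def numeral_2_eq_2 power2_eq_square)
  next
    case False
    then have "pair_level unit_seq k j = 0" if "j \<le> k" for j
      using that by (auto simp: pair_level_def taylor_def unit_seq_def)
    then show ?thesis
      using False by (simp add: level_contact_def binomial_avg_eq_sum)
  qed
  then have eq: "level_contact unit_seq = (\<lambda>k. if k = 2 then 1 / 2 else 0)" by auto
  have "level_contact unit_seq sums (1 / 2)"
    unfolding eq using sums_single[of 2 "\<lambda>_. 1 / 2 :: real"] by simp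
  then show ?thesis
    by (simp add: contact_energy_def sums_iff)
qed

lemma fock_expansion_phi1:
  defines "c \<equiv> \<lambda>n. if n = 1 then complex_of_real (1 / sqrt pi) else 0"
  shows "fock_expansion phi1 (\<lambda>z. complex_of_real (1 / sqrt pi) * z) c" "fock_coeff c = unit_seq"
proof -
  have "(\<lambda>n. c n * z ^ n) sums (complex_of_real (1 / sqrt pi) * z)" for z
  proof -
    have "(\<lambda>n. c n * z ^ n) = (\<lambda>n. if n = 1 then complex_of_real (1 / sqrt pi) * z ^ n else 0)"
      by (auto simp: c_def)
    then show ?thesis
      using sums_single[of 1 "\<lambda>n. complex_of_real (1 / sqrt pi) * z ^ n"] by simp
  qed
  then show "fock_expansion phi1 (\<lambda>z. complex_of_real (1 / sqrt pi) * z) c"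
    by unfold_locales (auto intro!: holomorphic_intros simp: phi1_def[abs_def] mult_ac)
  show "fock_coeff c = unit_seq"
    by (auto simp: fock_coeff_def c_def unit_seq_def fun_eq_iff)
qed

text \<open>Mode 1 exhausts the mass, so all other coefficients vanish and the argument of this one
  is the phase. Space rotations act on \<open>phi1\<close> as phase rotations, so the angle 0
  suffices.\<close>

lemma phase_rotation_of_coeff:
  assumes "fock_expansion v f c" and norm: "norm_sq (fock_coeff c) = 1"
    and ss: "square_summable (fock_coeff c)" and one: "cmod (fock_coeff c 1) = 1"
  obtains \<gamma> where "v = phase_rotation \<gamma> (space_rotation 0 phi1)"
proof -
  interpret fock_expansion v f c by fact
  have zero: "c n = 0" if "n \<noteq> 1" for n
  proof -
    have "(\<Sum>n\<in>{1, n}. (cmod (fock_coeff c n))\<^sup>2) \<le> norm_sq (fock_coeff c)"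
      unfolding norm_sq_def using ss by (intro sum_le_suminf) (auto simp: square_summable_def)
    then have "(cmod (fock_coeff c n))\<^sup>2 \<le> 0" using that one norm by simp
    then show ?thesis by (simp add: fock_coeff_def)
  qed
  have f: "f z = c 1 * z" for z
  proof -
    have "(\<lambda>n. c n * z ^ n) = (\<lambda>n. if n = 1 then c n * z ^ n else 0)"
      using zero by auto
    then have "(\<lambda>n. c n * z ^ n) sums (c 1 * z ^ 1)"
      using sums_single[of 1 "\<lambda>n. c n * z ^ n"] by simp
    with expansion[of z] show ?thesis using sums_unique2 by fastforce
  qed
  define \<gamma> where "\<gamma> = Arg (fock_coeff c 1)"
  have "fock_coeff c 1 = exp (\<i> * complex_of_real \<gamma>)"
    using Arg_eq[of "fock_coeff c 1"] one unfolding \<gamma>_def by force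
  moreover have "fock_coeff c 1 = complex_of_real (sqrt pi) * c 1"
    by (simp add: fock_coeff_def)
  ultimately have "c 1 = exp (\<i> * complex_of_real \<gamma>) * complex_of_real (1 / sqrt pi)"
    by (simp add: field_simps)
  then have "v = phase_rotation \<gamma> (space_rotation 0 phi1)"
    unfolding u_def f phase_rotation_def space_rotation_def phi1_def by (simp add: mult_ac)
  then show thesis by (rule that)
qed

theorem theorem1p6:
  shows "\<exists>\<mu>\<^sub>0 \<in> {5/32 ..< 1/2 :: real}. \<forall>\<mu> \<in> {\<mu>\<^sub>0 <..< 1/2}.
           unique_global_minimizer_up_to_rotations \<mu> phi1"
proof (intro bexI ballI)
  show "(1 / 2 - 1 / 10 ^ 13 :: real) \<in> {5/32 ..< 1/2}" by simp
  fix \<mu> :: real assume \<mu>: "\<mu> \<in> {1 / 2 - 1 / 10 ^ 13 <..< 1 / 2}"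
  define \<epsilon> where "\<epsilon> = 1 / 2 - \<mu>"
  have \<epsilon>: "0 < \<epsilon>" "\<epsilon> < 1 / 10 ^ 13" using \<mu> by (auto simp: \<epsilon>_def)
  have \<mu>0: "0 < \<mu>" using \<epsilon> by (simp add: \<epsilon>_def)
  \<comment> \<open>Centres the functional at 1 / 2 + \<mu>, its value at \<open>phi1\<close>, so
    that minimality and uniqueness are the two parts of \<open>energy_gap\<close>.\<close>
  have G: "contact_energy a + \<mu> * momentum a = 1 / 2 + \<mu> + (excess a - \<epsilon> * (momentum a - 1))" for a
    by (simp add: excess_def \<epsilon>_def field_simps)
  interpret phi: fock_expansion phi1 "\<lambda>z. complex_of_real (1 / sqrt pi) * z"
    "\<lambda>n. if n = 1 then complex_of_real (1 / sqrt pi) else 0"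
    by (rule fock_expansion_phi1)
  note coeff = fock_expansion_phi1(2)
  have Gphi: "functional_G \<mu> phi1 = ereal (1 / 2 + \<mu>)"
    using phi.functional_G_finite[of \<mu>] unfolding coeff
    by (simp add: unit_seq_square_summable finite_momentum_unit_seq contact_energy_unit_seq momentum_unit_seq)
  have "phi1 \<in> bargmann_fock" "mass_M phi1 = 1"
    using phi.bargmann_fock_iff phi.mass_eq unfolding coeff
    by (simp_all add: unit_seq_square_summable norm_sq_unit_seq)
  moreover have "functional_G \<mu> phi1 \<le> functional_G \<mu> v"
    and "functional_G \<mu> v \<le> functional_G \<mu> phi1 \<Longrightarrow>
      \<exists>\<gamma> \<theta>. v = phase_rotation \<gamma> (space_rotation \<theta> phi1)"
    if v: "v \<in> bargmann_fock" "mass_M v = 1" for v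
  proof -
    obtain f c where "fock_expansion v f c" using v(1) by (rule bargmann_fock_expansion)
    then interpret v: fock_expansion v f c .
    have ss: "square_summable v.coeff" using v(1) by (simp only: v.bargmann_fock_iff)
    have one: "norm_sq v.coeff = 1" using v(2) by (simp only: v.mass_eq[OF ss])
    show "functional_G \<mu> phi1 \<le> functional_G \<mu> v"
    proof (cases "finite_momentum v.coeff")
      case True
      then show ?thesis
        using energy_gap(1)[OF True one \<epsilon>] by (simp add: v.functional_G_finite[OF ss] Gphi G)
    next
      case False
      then show ?thesis using \<mu>0 by (simp add: v.functional_G_infinite[OF ss])
    qed
    assume le: "functional_G \<mu> v \<le> functional_G \<mu> phi1"
    have fm: "finite_momentum v.coeff"
      using le v.functional_G_infinite[OF ss _ \<mu>0] by (cases "finite_momentum v.coeff") (auto simp: Gphi)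
    have "excess v.coeff - \<epsilon> * (momentum v.coeff - 1) = 0"
      using le energy_gap(1)[OF fm one \<epsilon>] by (simp add: v.functional_G_finite[OF ss fm] Gphi G)
    then have "cmod (v.coeff 1) = 1" by (rule energy_gap(2)[OF fm one \<epsilon>])
    then show "\<exists>\<gamma> \<theta>. v = phase_rotation \<gamma> (space_rotation \<theta> phi1)"
      using phase_rotation_of_coeff[OF v.fock_expansion_axioms one ss] by metis
  qed
  ultimately show "unique_global_minimizer_up_to_rotations \<mu> phi1"
    unfolding unique_global_minimizer_up_to_rotations_def global_minimizer_def by blast
qed

end
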